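(* Let $(M^m,g)$ and $(N^n,h)$ be Riemannian manifolds, let $\psi:(M^m,g)\to\mathbb{R}^k$ be a generalized harmonic morphism and let $\varphi:(N^n,h)\to\mathbb{R}^k$ be a harmonic morphism. Then their direct sum $\psi\oplus\varphi:(M^m\times N^n,\,G=g\times h)\to\mathbb{R}^k$ is a generalized harmonic morphism. In particular, $\psi\oplus\varphi$ is a horizontally weakly conformal proper biharmonic map.
   Context: All manifolds and maps are smooth; $\mathbb{R}^k$ carries the Euclidean metric and $M\times N$ the product metric $G=g\times h$. The direct sum of $\psi:M\to\mathbb{R}^k$ and $\varphi:N\to\mathbb{R}^k$ is the map $(\psi\oplus\varphi)(x,y)=\psi(x)+\varphi(y)$ on $M\times N$. A function $u$ is harmonic if $\Delta u=0$ and biharmonic if $\Delta^2u=0$, with $\Delta$ the Laplace–Beltrami operator. A map $\phi:(M,g)\to(N,h)$ is a harmonic morphism (respectively a generalized harmonic morphism) if for every harmonic function $f:U\to\mathbb{R}$ on an open set $U\subseteq N$ with $\phi^{-1}(U)$ non-empty, $f\circ\phi$ is harmonic (respectively biharmonic) on $\phi^{-1}(U)$. A map into $\mathbb{R}^k$ is a harmonic (respectively biharmonic) map if and only if each of its component functions is harmonic (respectively biharmonic); a proper biharmonic map is a biharmonic map which is not harmonic. A map $\phi:(M,g)\to(N,h)$ is horizontally weakly conformal if there is a function $\lambda:M\to[0,\infty)$ such that at each $x\in M$ either $d\phi_x=0$, or $d\phi_x$ is surjective and $h(d\phi_x(X),d\phi_x(Y))=\lambda(x)^2g(X,Y)$ for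 all $X,Y\in(\ker d\phi_x)^{\perp}$.
   Formalization: That ψ⊕φ is proper (not harmonic) is proved under the extra assumption that ψ is not a harmonic map; without it the claim fails, e.g. for constant ψ and φ, whose direct sum is harmonic. All other conclusions are unconditional. *)

theory Defs
  imports "HOL-Analysis.Analysis"
begin

section \<open>Smooth functions between normed spaces\<close>

text \<open>For open \<open>S\<close> in a finite-dimensional space, \<open>Ck_on n f S\<close> says that \<open>f\<close> is \<open>n\<close> times
  continuously differentiable on \<open>S\<close>.\<close>

primrec Ck_on ::
  "nat \<Rightarrow> ('a::real_normed_vector \<Rightarrow> 'b::real_normed_vector) \<Rightarrow> 'a set \<Rightarrow> bool" where
  "Ck_on 0 f S \<longleftrightarrow> continuous_on S f"
| "Ck_on (Suc n) f S \<longleftrightarrow>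
     (\<forall>x\<in>S. f differentiable (at x)) \<and>
     (\<forall>v. Ck_on n (\<lambda>x. frechet_derivative f (at x) v) S)"

definition smooth_on ::
  "('a::real_normed_vector \<Rightarrow> 'b::real_normed_vector) \<Rightarrow> 'a set \<Rightarrow> bool" where
  "smooth_on f S \<longleftrightarrow> (\<forall>n. Ck_on n f S)"

definition partial :: "'m \<Rightarrow> (real^'m::finite \<Rightarrow> real) \<Rightarrow> real^'m \<Rightarrow> real" where
  "partial a F x = frechet_derivative F (at x) (axis a 1)"

section \<open>Riemannian manifolds\<close>

text \<open>The atlas is an indexed family of charts \<open>chart M i : dom M i \<rightarrow> \<real>^m\<close>, \<open>i \<in> index M\<close>; it need not
  be maximal. The tangent space at \<open>p\<close> is identified with \<open>\<real>^m\<close> through each chart around \<open>p\<close>, and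
  \<open>metric M i p\<close> is the inner product at \<open>p\<close> read through chart \<open>i\<close>.\<close>

record ('i, 'p, 'm) rmfd =
  carrier_top :: "'p topology"
  index :: "'i set"
  dom :: "'i \<Rightarrow> 'p set"
  chart :: "'i \<Rightarrow> 'p \<Rightarrow> real^'m"
  metric :: "'i \<Rightarrow> 'p \<Rightarrow> real^'m \<Rightarrow> real^'m \<Rightarrow> real"

abbreviation points :: "('i, 'p, 'm::finite) rmfd \<Rightarrow> 'p set" where
  "points M \<equiv> topspace (carrier_top M)"

definition chart_inv :: "('i, 'p, 'm::finite) rmfd \<Rightarrow> 'i \<Rightarrow> real^'m \<Rightarrow> 'p" where
  "chart_inv M i = inv_into (dom M i) (chart M i)"

definition smooth_atlas :: "('i, 'p, 'm::finite) rmfd \<Rightarrow> bool" where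
  "smooth_atlas M \<longleftrightarrow>
     (\<Union>i\<in>index M. dom M i) = points M \<and>
     (\<forall>i\<in>index M.
        openin (carrier_top M) (dom M i) \<and> open (chart M i ` dom M i) \<and>
        homeomorphic_map (subtopology (carrier_top M) (dom M i))
          (top_of_set (chart M i ` dom M i)) (chart M i)) \<and>
     (\<forall>i\<in>index M. \<forall>j\<in>index M.
        smooth_on (chart M j \<circ> chart_inv M i) (chart M i ` (dom M i \<inter> dom M j)))"

definition riemannian_metric :: "('i, 'p, 'm::finite) rmfd \<Rightarrow> bool" where
  "riemannian_metric M \<longleftrightarrow>
     (\<forall>i\<in>index M. \<forall>p\<in>dom M i.
        bilinear (metric M i p) \<and>
        (\<forall>u v. metric M i p u v = metric M i p v u) \<and>
        (\<forall>u. u \<noteq> 0 \<longrightarrow> metric M i p u u > 0)) \<and>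
     (\<forall>i\<in>index M. \<forall>u v.
        smooth_on (\<lambda>x. metric M i (chart_inv M i x) u v) (chart M i ` dom M i)) \<and>
     (\<forall>i\<in>index M. \<forall>j\<in>index M. \<forall>p\<in>dom M i \<inter> dom M j.
        let T = frechet_derivative (chart M j \<circ> chart_inv M i) (at (chart M i p))
        in \<forall>u v. metric M i p u v = metric M j p (T u) (T v))"

definition riemannian_manifold :: "('i, 'p, 'm::finite) rmfd \<Rightarrow> bool" where
  "riemannian_manifold M \<longleftrightarrow>
     points M \<noteq> {} \<and> Hausdorff_space (carrier_top M) \<and> second_countable (carrier_top M) \<and>
     smooth_atlas M \<and> riemannian_metric M"

definition euclidean_mfd :: "(unit, real^'k, 'k::finite) rmfd" where
  "euclidean_mfd =
     \<lparr> carrier_top = euclidean, index = UNIV, dom = (\<lambda>_. UNIV), chart = (\<lambda>_ x. x),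
       metric = (\<lambda>_ _ u v. u \<bullet> v) \<rparr>"

text \<open>\<open>\<real>^(m+n)\<close> is indexed by the sum type, which identifies it with the product of \<open>\<real>^m\<close> and \<open>\<real>^n\<close>.\<close>

definition join_vec :: "real^'m::finite \<Rightarrow> real^'n::finite \<Rightarrow> real^('m + 'n)" where
  "join_vec u v = (\<chi> a. case a of Inl b \<Rightarrow> u $ b | Inr c \<Rightarrow> v $ c)"

definition left_vec :: "real^('m::finite + 'n::finite) \<Rightarrow> real^'m" where
  "left_vec w = (\<chi> b. w $ Inl b)"

definition right_vec :: "real^('m::finite + 'n::finite) \<Rightarrow> real^'n" where
  "right_vec w = (\<chi> c. w $ Inr c)"

definition product_mfd ::
  "('i, 'p, 'm::finite) rmfd \<Rightarrow> ('j, 'q, 'n::finite) rmfd \<Rightarrow> ('i \<times> 'j, 'p \<times> 'q, 'm + 'n) rmfd"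
  where
  "product_mfd M N =
     \<lparr> carrier_top = prod_topology (carrier_top M) (carrier_top N),
       index = index M \<times> index N,
       dom = (\<lambda>(i, j). dom M i \<times> dom N j),
       chart = (\<lambda>(i, j) (x, y). join_vec (chart M i x) (chart N j y)),
       metric = (\<lambda>(i, j) (x, y) u v.
         metric M i x (left_vec u) (left_vec v) + metric N j y (right_vec u) (right_vec v)) \<rparr>"

section \<open>Smooth functions and maps\<close>

definition smooth_fun_on :: "('i, 'p, 'm::finite) rmfd \<Rightarrow> 'p set \<Rightarrow> ('p \<Rightarrow> real) \<Rightarrow> bool" where
  "smooth_fun_on M W f \<longleftrightarrow>
     (\<forall>i\<in>index M. smooth_on (f \<circ> chart_inv M i) (chart M i ` (dom M i \<inter> W)))"

definition smooth_map ::
  "('i, 'p, 'm::finite) rmfd \<Rightarrow> ('j, 'q, 'n::finite) rmfd \<Rightarrow> ('p \<Rightarrow> 'q) \<Rightarrow> bool" where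
  "smooth_map M N \<phi> \<longleftrightarrow>
     continuous_map (carrier_top M) (carrier_top N) \<phi> \<and>
     (\<forall>i\<in>index M. \<forall>j\<in>index N.
        smooth_on (chart N j \<circ> \<phi> \<circ> chart_inv M i) (chart M i ` (dom M i \<inter> \<phi> -` dom N j)))"

definition differential ::
  "('i, 'p, 'm::finite) rmfd \<Rightarrow> ('j, 'q, 'n::finite) rmfd \<Rightarrow> ('p \<Rightarrow> 'q) \<Rightarrow> 'i \<Rightarrow> 'j \<Rightarrow> 'p \<Rightarrow>
   real^'m \<Rightarrow> real^'n" where
  "differential M N \<phi> i j p =
     frechet_derivative (chart N j \<circ> \<phi> \<circ> chart_inv M i) (at (chart M i p))"

section \<open>The Laplace--Beltrami operator\<close>

definition metric_coeff ::
  "('i, 'p, 'm::finite) rmfd \<Rightarrow> 'i \<Rightarrow> 'm \<Rightarrow> 'm \<Rightarrow> real^'m \<Rightarrow> real" where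
  "metric_coeff M i a b x = metric M i (chart_inv M i x) (axis a 1) (axis b 1)"

definition inverse_metric_coeff ::
  "('i, 'p, 'm::finite) rmfd \<Rightarrow> 'i \<Rightarrow> 'm \<Rightarrow> 'm \<Rightarrow> real^'m \<Rightarrow> real" where
  "inverse_metric_coeff M i a b x = matrix_inv (\<chi> c d. metric_coeff M i c d x) $ a $ b"

definition christoffel ::
  "('i, 'p, 'm::finite) rmfd \<Rightarrow> 'i \<Rightarrow> 'm \<Rightarrow> 'm \<Rightarrow> 'm \<Rightarrow> real^'m \<Rightarrow> real" where
  "christoffel M i c a b x =
     (1/2) * (\<Sum>d\<in>UNIV. inverse_metric_coeff M i c d x *
       (partial a (metric_coeff M i b d) x + partial b (metric_coeff M i a d) x
        - partial d (metric_coeff M i a b) x))"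

text \<open>The trace of the covariant Hessian in the coordinates \<open>x\<close> of chart \<open>i\<close>:
  \<open>\<Delta>F = g^{ab} (\<partial>\<^sub>a \<partial>\<^sub>b F - \<Gamma>^c_{ab} \<partial>\<^sub>c F)\<close>.\<close>

definition coord_laplacian ::
  "('i, 'p, 'm::finite) rmfd \<Rightarrow> 'i \<Rightarrow> (real^'m \<Rightarrow> real) \<Rightarrow> real^'m \<Rightarrow> real" where
  "coord_laplacian M i F x =
     (\<Sum>a\<in>UNIV. \<Sum>b\<in>UNIV. inverse_metric_coeff M i a b x *
        (partial a (partial b F) x - (\<Sum>c\<in>UNIV. christoffel M i c a b x * partial c F x)))"

text \<open>\<open>has_laplacian M W f u\<close> states \<open>\<Delta>f = u\<close> on the open set \<open>W\<close>: the value of \<open>u\<close> at each point is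
  given by the coordinate formula in every chart around it. For smooth \<open>f\<close> such a \<open>u\<close> exists, because
  the formula does not depend on the chart, and is unique on \<open>W\<close>.\<close>

definition has_laplacian ::
  "('i, 'p, 'm::finite) rmfd \<Rightarrow> 'p set \<Rightarrow> ('p \<Rightarrow> real) \<Rightarrow> ('p \<Rightarrow> real) \<Rightarrow> bool" where
  "has_laplacian M W f u \<longleftrightarrow>
     (\<forall>i\<in>index M. \<forall>p\<in>dom M i \<inter> W. u p = coord_laplacian M i (f \<circ> chart_inv M i) (chart M i p))"

definition harmonic_on :: "('i, 'p, 'm::finite) rmfd \<Rightarrow> 'p set \<Rightarrow> ('p \<Rightarrow> real) \<Rightarrow> bool" where
  "harmonic_on M W f \<longleftrightarrow> smooth_fun_on M W f \<and> has_laplacian M W f (\<lambda>_. 0)"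

definition biharmonic_on :: "('i, 'p, 'm::finite) rmfd \<Rightarrow> 'p set \<Rightarrow> ('p \<Rightarrow> real) \<Rightarrow> bool" where
  "biharmonic_on M W f \<longleftrightarrow>
     smooth_fun_on M W f \<and> (\<exists>u. has_laplacian M W f u \<and> has_laplacian M W u (\<lambda>_. 0))"

section \<open>Harmonic morphisms and related classes of maps\<close>

definition harmonic_morphism ::
  "('i, 'p, 'm::finite) rmfd \<Rightarrow> ('j, 'q, 'n::finite) rmfd \<Rightarrow> ('p \<Rightarrow> 'q) \<Rightarrow> bool" where
  "harmonic_morphism M N \<phi> \<longleftrightarrow>
     smooth_map M N \<phi> \<and>
     (\<forall>U f. openin (carrier_top N) U \<and> points M \<inter> \<phi> -` U \<noteq> {} \<and> harmonic_on N U f \<longrightarrow>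
        harmonic_on M (points M \<inter> \<phi> -` U) (f \<circ> \<phi>))"

definition generalized_harmonic_morphism ::
  "('i, 'p, 'm::finite) rmfd \<Rightarrow> ('j, 'q, 'n::finite) rmfd \<Rightarrow> ('p \<Rightarrow> 'q) \<Rightarrow> bool" where
  "generalized_harmonic_morphism M N \<phi> \<longleftrightarrow>
     smooth_map M N \<phi> \<and>
     (\<forall>U f. openin (carrier_top N) U \<and> points M \<inter> \<phi> -` U \<noteq> {} \<and> harmonic_on N U f \<longrightarrow>
        biharmonic_on M (points M \<inter> \<phi> -` U) (f \<circ> \<phi>))"

definition harmonic_map :: "('i, 'p, 'm::finite) rmfd \<Rightarrow> ('p \<Rightarrow> real^'k::finite) \<Rightarrow> bool" where
  "harmonic_map M \<phi> \<longleftrightarrow>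
     smooth_map M euclidean_mfd \<phi> \<and> (\<forall>l. harmonic_on M (points M) (\<lambda>p. \<phi> p $ l))"

definition biharmonic_map :: "('i, 'p, 'm::finite) rmfd \<Rightarrow> ('p \<Rightarrow> real^'k::finite) \<Rightarrow> bool" where
  "biharmonic_map M \<phi> \<longleftrightarrow>
     smooth_map M euclidean_mfd \<phi> \<and> (\<forall>l. biharmonic_on M (points M) (\<lambda>p. \<phi> p $ l))"

definition proper_biharmonic_map ::
  "('i, 'p, 'm::finite) rmfd \<Rightarrow> ('p \<Rightarrow> real^'k::finite) \<Rightarrow> bool" where
  "proper_biharmonic_map M \<phi> \<longleftrightarrow> biharmonic_map M \<phi> \<and> \<not> harmonic_map M \<phi>"

definition horizontal_space ::
  "('i, 'p, 'm::finite) rmfd \<Rightarrow> ('j, 'q, 'n::finite) rmfd \<Rightarrow> ('p \<Rightarrow> 'q) \<Rightarrow> 'i \<Rightarrow> 'j \<Rightarrow> 'p \<Rightarrow>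
   (real^'m) set" where
  "horizontal_space M N \<phi> i j p =
     {X. \<forall>V. differential M N \<phi> i j p V = 0 \<longrightarrow> metric M i p X V = 0}"

definition horizontally_weakly_conformal ::
  "('i, 'p, 'm::finite) rmfd \<Rightarrow> ('j, 'q, 'n::finite) rmfd \<Rightarrow> ('p \<Rightarrow> 'q) \<Rightarrow> bool" where
  "horizontally_weakly_conformal M N \<phi> \<longleftrightarrow>
     smooth_map M N \<phi> \<and>
     (\<exists>lam :: 'p \<Rightarrow> real. (\<forall>p\<in>points M. lam p \<ge> 0) \<and>
        (\<forall>i\<in>index M. \<forall>j\<in>index N. \<forall>p\<in>dom M i \<inter> \<phi> -` dom N j.
           let d = differential M N \<phi> i j p; H = horizontal_space M N \<phi> i j p
           in (\<forall>X. d X = 0) \<or>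
              surj d \<and>
              (\<forall>X\<in>H. \<forall>Y\<in>H. metric N j (\<phi> p) (d X) (d Y) = (lam p)\<^sup>2 * metric M i p X Y)))"

definition map_direct_sum :: "('p \<Rightarrow> 'a::plus) \<Rightarrow> ('q \<Rightarrow> 'a) \<Rightarrow> 'p \<times> 'q \<Rightarrow> 'a" where
  "map_direct_sum \<psi> \<phi> = (\<lambda>(x, y). \<psi> x + \<phi> y)"

end

theory Submission
  imports Defs
begin

text \<open>Write $\Phi = \psi \oplus \varphi$ and let $f$ be harmonic on an open set of $\mathbb{R}^k$. Freezing
$y$, the translate $f(\cdot + \varphi(y))$ is again harmonic, so $x \mapsto f(\psi(x) + \varphi(y))$ is
biharmonic on $M$ because $\psi$ is a generalized harmonic morphism; freezing $x$,
$y \mapsto f(\psi(x) + \varphi(y))$ is harmonic on $N$ because $\varphi$ is a harmonic morphism. The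
Laplacian of the product metric is $\Delta_M + \Delta_N$, and the two summands commute, being operators
in separate variables. Hence, with $F = f \circ \Phi$,
$\Delta F = \Delta_M F$ and $\Delta^2 F = \Delta_M^2 F + \Delta_M \Delta_N F = 0$. In coordinates this is
\<open>product_laplacian\<close>, \<open>second_order_op_slices_commute\<close> and \<open>product_bilaplacian\<close>; the conclusion is
\<open>generalized_harmonic_morphism_direct_sum\<close>.

Horizontal weak conformality holds for every generalized harmonic morphism $\phi$ into $\mathbb{R}^k$,
and is applied to $\Phi$ on the product, which is again a Riemannian manifold. It amounts to the Gram
matrix $\langle \nabla\phi^\alpha, \nabla\phi^\beta \rangle$ being a multiple of the identity. For
functions $F_1, \dots, F_4$ vanishing at a point,
$\Delta^2 (F_1 F_2 F_3 F_4)$ depends at that point only on the inner products of their gradients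
(\<open>second_order_op_square_quartic\<close>). The real and imaginary parts of
$((z_\alpha - c_\alpha) + i (z_\beta - c_\beta))^4$ are harmonic on $\mathbb{R}^k$; taking $c = \phi(p)$ and
writing $w$ for $\phi^\alpha - c_\alpha + i (\phi^\beta - c_\beta)$, biharmonicity of the pullback says
$24 \langle \nabla w, \nabla w \rangle^2 = 0$ at $p$ for the complex-bilinear product. So
$\nabla\phi^\alpha$ and $\nabla\phi^\beta$ are orthogonal and of equal length
(\<open>generalized_harmonic_morphism_gram\<close>).

The remaining claims follow by testing with the coordinate functions of $\mathbb{R}^k$: the components of
$\Phi$ are biharmonic, and $\Delta \Phi^l = \Delta_M \psi^l$, so that $\Phi$ is harmonic only if $\psi$
is.\<close>

section \<open>Calculus of smooth functions\<close>

lemma frechet_derivative_cong_open: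
  assumes "open S" "x \<in> S" "\<And>y. y \<in> S \<Longrightarrow> f y = g y"
  shows "frechet_derivative f (at x) = frechet_derivative g (at x)"
proof -
  have "(f has_derivative D) (at x) \<longleftrightarrow> (g has_derivative D) (at x)" for D
    using assms has_derivative_transform_within_open[of f D x UNIV S g]
      has_derivative_transform_within_open[of g D x UNIV S f] by auto
  then show ?thesis by (simp add: frechet_derivative_def)
qed

lemma differentiable_cong_open:
  assumes "open S" "x \<in> S" "\<And>y. y \<in> S \<Longrightarrow> f y = g y" "f differentiable (at x)"
  shows "g differentiable (at x)"
  using assms has_derivative_transform_within_open[of f _ x UNIV S g]
  by (auto simp: differentiable_def)

lemma Ck_on_cong:
  assumes "open S" "\<And>x. x \<in> S \<Longrightarrow> f x = g x" "Ck_on n f S"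
  shows "Ck_on n g S"
  using assms(2,3)
proof (induction n arbitrary: f g)
  case 0
  then show ?case by (simp cong: continuous_on_cong)
next
  case (Suc n)
  have "g differentiable (at x)" if "x \<in> S" for x
    using differentiable_cong_open[OF assms(1) that, of f g] Suc.prems that by auto
  moreover have "Ck_on n (\<lambda>x. frechet_derivative g (at x) v) S" for v
  proof (rule Suc.IH)
    show "Ck_on n (\<lambda>x. frechet_derivative f (at x) v) S" using Suc.prems by auto
    show "frechet_derivative f (at x) v = frechet_derivative g (at x) v" if "x \<in> S" for x
      using frechet_derivative_cong_open[OF assms(1) that, of f g] Suc.prems(1) by simp
  qed
  ultimately show ?case by simp
qed

lemma Ck_on_subset: "Ck_on n f S \<Longrightarrow> T \<subseteq> S \<Longrightarrow> Ck_on n f T"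
  by (induction n arbitrary: f) (auto intro: continuous_on_subset)

lemma Ck_on_Suc_imp: "Ck_on (Suc n) f S \<Longrightarrow> Ck_on n f S"
proof (induction n arbitrary: f)
  case 0
  then show ?case
    by (auto intro!: continuous_at_imp_continuous_on differentiable_imp_continuous_within)
next
  case (Suc n)
  from Suc.prems Suc.IH show ?case unfolding Ck_on.simps(2)[of "Suc n"] Ck_on.simps(2)[of n f] by blast
qed

lemma smooth_on_cong:
  "open S \<Longrightarrow> (\<And>x. x \<in> S \<Longrightarrow> f x = g x) \<Longrightarrow> smooth_on f S \<Longrightarrow> smooth_on g S"
  unfolding smooth_on_def using Ck_on_cong by blast

lemma smooth_on_subset: "smooth_on f S \<Longrightarrow> T \<subseteq> S \<Longrightarrow> smooth_on f T"
  unfolding smooth_on_def using Ck_on_subset by blast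

lemma smooth_on_differentiable: "smooth_on f S \<Longrightarrow> x \<in> S \<Longrightarrow> f differentiable (at x)"
  unfolding smooth_on_def by (metis Ck_on.simps(2))

lemma smooth_on_has_derivative:
  "smooth_on f S \<Longrightarrow> x \<in> S \<Longrightarrow> (f has_derivative frechet_derivative f (at x)) (at x)"
  using smooth_on_differentiable frechet_derivative_works by blast

lemma smooth_on_derivative:
  "smooth_on f S \<Longrightarrow> smooth_on (\<lambda>x. frechet_derivative f (at x) v) S"
  unfolding smooth_on_def by (metis Ck_on.simps(2))

lemma smooth_on_continuous: "smooth_on f S \<Longrightarrow> continuous_on S f"
  unfolding smooth_on_def by (metis Ck_on.simps(1))

lemma Ck_on_const: "Ck_on n (\<lambda>x. c) S"
  by (induction n arbitrary: c) auto

lemma smooth_on_const: "smooth_on (\<lambda>x. c) S"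
  by (simp add: smooth_on_def Ck_on_const)

lemma smooth_on_linear:
  assumes "bounded_linear f"
  shows "smooth_on f S"
  unfolding smooth_on_def
proof
  fix n
  have f: "frechet_derivative f (at x) = f" for x
    using frechet_derivative_at[OF bounded_linear_imp_has_derivative[OF assms]] by simp
  have c: "Ck_on n (\<lambda>x. f v) S" for n v by (rule Ck_on_const)
  show "Ck_on n f S"
  proof (cases n)
    case 0
    then show ?thesis using assms by (simp add: linear_continuous_on)
  next
    case (Suc k)
    then show ?thesis using assms f c by (auto intro: bounded_linear_imp_differentiable)
  qed
qed

text \<open>Any family of derivatives may be used to prove differentiability of one more order, because on an
  open set it coincides with the one chosen by \<open>frechet_derivative\<close>.\<close>

lemma Ck_on_step:
  assumes "open S" "\<And>x. x \<in> S \<Longrightarrow> (f has_derivative D x) (at x)"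
    and "\<And>v. Ck_on n (\<lambda>x. D x v) S"
  shows "Ck_on (Suc n) f S"
proof -
  have "D x = frechet_derivative f (at x)" if "x \<in> S" for x
    using frechet_derivative_at[OF assms(2)[OF that]] .
  then have "Ck_on n (\<lambda>x. frechet_derivative f (at x) v) S" for v
    using Ck_on_cong[OF assms(1) _ assms(3)[of v]] by simp
  then show ?thesis using assms(2) by (auto simp: differentiable_def)
qed

lemma Ck_on_has_derivative:
  "Ck_on (Suc n) f S \<Longrightarrow> x \<in> S \<Longrightarrow> (f has_derivative frechet_derivative f (at x)) (at x)"
  using frechet_derivative_works by auto

lemma Ck_on_add:
  assumes "open S" "Ck_on n f S" "Ck_on n g S"
  shows "Ck_on n (\<lambda>x. f x + g x) S"
  using assms(2,3)
proof (induction n arbitrary: f g)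
  case 0
  then show ?case by (simp add: continuous_on_add)
next
  case (Suc n)
  show ?case
    by (rule Ck_on_step[OF assms(1) has_derivative_add[OF Ck_on_has_derivative[OF Suc.prems(1)]
          Ck_on_has_derivative[OF Suc.prems(2)]]])
      (use Suc in auto)
qed

lemma Ck_on_mult:
  fixes f g :: "'a::real_normed_vector \<Rightarrow> real"
  assumes "open S" "Ck_on n f S" "Ck_on n g S"
  shows "Ck_on n (\<lambda>x. f x * g x) S"
  using assms(2,3)
proof (induction n arbitrary: f g)
  case 0
  then show ?case by (simp add: continuous_on_mult)
next
  case (Suc n)
  show ?case
  proof (rule Ck_on_step[OF assms(1) has_derivative_mult[OF Ck_on_has_derivative[OF Suc.prems(1)]
        Ck_on_has_derivative[OF Suc.prems(2)]]])
    show "Ck_on n (\<lambda>x. f x * frechet_derivative g (at x) v + frechet_derivative f (at x) v * g x) S" for v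
      using Suc.prems Ck_on_Suc_imp[OF Suc.prems(1)] Ck_on_Suc_imp[OF Suc.prems(2)]
      by (intro Ck_on_add[OF assms(1)] Suc.IH) auto
  qed
qed

lemma Ck_on_sum:
  assumes "open S" "\<And>i. i \<in> I \<Longrightarrow> Ck_on n (f i) S"
  shows "Ck_on n (\<lambda>x. \<Sum>i\<in>I. f i x) S"
  using assms(2) by (induction I rule: infinite_finite_induct) (auto intro: Ck_on_const Ck_on_add assms(1))

lemma Ck_on_inverse:
  fixes f :: "'a::real_normed_vector \<Rightarrow> real"
  assumes "open S" "Ck_on n f S" "\<And>x. x \<in> S \<Longrightarrow> f x \<noteq> 0"
  shows "Ck_on n (\<lambda>x. inverse (f x)) S"
  using assms(2)
proof (induction n)
  case 0
  then show ?case using assms(3) by (simp add: continuous_on_inverse)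
next
  case (Suc n)
  have i: "Ck_on n (\<lambda>x. inverse (f x)) S" using Suc Ck_on_Suc_imp by blast
  show ?case
  proof (rule Ck_on_step[OF assms(1)])
    show "((\<lambda>x. inverse (f x)) has_derivative
        (\<lambda>h. (-1) * (inverse (f x) * frechet_derivative f (at x) h * inverse (f x)))) (at x)" if "x \<in> S" for x
      using Deriv.has_derivative_inverse[OF assms(3)[OF that] Ck_on_has_derivative[OF Suc.prems that]] by simp
    show "Ck_on n (\<lambda>x. (-1) * (inverse (f x) * frechet_derivative f (at x) v * inverse (f x))) S" for v
      using Suc.prems i by (intro Ck_on_mult[OF assms(1)] Ck_on_const) auto
  qed
qed

text \<open>The directional derivatives of a composite are sums of products of a component of the inner
  derivative with a partial derivative of the outer function composed with the inner one, so the
  induction hypothesis applies to the latter.\<close>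

lemma Ck_on_comp:
  fixes f :: "real^'k::finite \<Rightarrow> real" and g :: "'a::real_normed_vector \<Rightarrow> real^'k"
  assumes "open S" "Ck_on n f T" "Ck_on n g S" "g ` S \<subseteq> T" 
  shows "Ck_on n (\<lambda>x. f (g x)) S"
  using assms(2,3)
proof (induction n arbitrary: f)
  case 0
  then show ?case using assms(4) by (auto intro: continuous_on_compose2)
next
  case (Suc n)
  let ?Df = "\<lambda>y. frechet_derivative f (at y)" and ?Dg = "\<lambda>x. frechet_derivative g (at x)"
  have cg: "Ck_on n (\<lambda>x. ?Dg x v $ l) S" for v l
  proof -
    have "Ck_on m (\<lambda>x. h x $ l) S" if "Ck_on m h S" for m and h :: "'a \<Rightarrow> real^'k"
      using that
    proof (induction m arbitrary: h)
      case 0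
      then show ?case by (auto intro: continuous_intros)
    next
      case (Suc m)
      show ?case
        by (rule Ck_on_step[OF assms(1) bounded_linear.has_derivative[OF bounded_linear_vec_nth Ck_on_has_derivative[OF Suc.prems]]])
          (use Suc in auto)
    qed
    then show ?thesis using Suc.prems by auto
  qed
  have ch: "((\<lambda>x. f (g x)) has_derivative
      (\<lambda>v. \<Sum>l\<in>UNIV. ?Dg x v $ l * ?Df (g x) (axis l 1))) (at x)" if "x \<in> S" for x
  proof -
    have gT: "g x \<in> T" using assms(4) that by auto
    have d: "(f has_derivative ?Df (g x)) (at (g x))"
      using Ck_on_has_derivative[OF Suc.prems(1) gT] .
    then have lin: "linear (?Df (g x))" by (rule has_derivative_linear)
    have ex: "?Df (g x) w = (\<Sum>l\<in>UNIV. w $ l * ?Df (g x) (axis l 1))" for w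
    proof -
      have "w = (\<Sum>l\<in>UNIV. (w $ l) *\<^sub>R axis l 1)"
        using basis_expansion[of w] by (simp add: scalar_mult_eq_scaleR)
      then have "?Df (g x) w = ?Df (g x) (\<Sum>l\<in>UNIV. (w $ l) *\<^sub>R axis l 1)" by simp
      also have "\<dots> = (\<Sum>l\<in>UNIV. w $ l * ?Df (g x) (axis l 1))"
        using lin by (simp add: linear_sum linear_scale)
      finally show ?thesis .
    qed
    have eq: "?Df (g x) \<circ> ?Dg x = (\<lambda>v. \<Sum>l\<in>UNIV. ?Dg x v $ l * ?Df (g x) (axis l 1))"
      by (intro ext, unfold o_def, rule ex)
    from diff_chain_at[OF Ck_on_has_derivative[OF Suc.prems(2) that] d]
    show ?thesis unfolding eq by (simp only: o_def)
  qed
  show ?case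
  proof (rule Ck_on_step[OF assms(1) ch])
    fix v
    have "Ck_on n (\<lambda>x. ?Df (g x) (axis l 1)) S" for l
      by (rule Suc.IH) (use Suc.prems(1) Ck_on_Suc_imp[OF Suc.prems(2)] in auto)
    then show "Ck_on n (\<lambda>x. \<Sum>l\<in>UNIV. ?Dg x v $ l * ?Df (g x) (axis l 1)) S"
      by (intro Ck_on_sum[OF assms(1)] Ck_on_mult[OF assms(1)] cg)
  qed
qed

lemma smooth_on_add: "open S \<Longrightarrow> smooth_on f S \<Longrightarrow> smooth_on g S \<Longrightarrow> smooth_on (\<lambda>x. f x + g x) S"
  unfolding smooth_on_def using Ck_on_add by blast

lemma smooth_on_mult:
  fixes f g :: "'a::real_normed_vector \<Rightarrow> real"
  shows "open S \<Longrightarrow> smooth_on f S \<Longrightarrow> smooth_on g S \<Longrightarrow> smooth_on (\<lambda>x. f x * g x) S"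
  unfolding smooth_on_def using Ck_on_mult by blast

lemma smooth_on_sum:
  "open S \<Longrightarrow> (\<And>i. i \<in> I \<Longrightarrow> smooth_on (f i) S) \<Longrightarrow> smooth_on (\<lambda>x. \<Sum>i\<in>I. f i x) S"
  unfolding smooth_on_def by (intro allI Ck_on_sum) blast+

lemma smooth_on_diff:
  fixes f g :: "'a::real_normed_vector \<Rightarrow> real"
  shows "open S \<Longrightarrow> smooth_on f S \<Longrightarrow> smooth_on g S \<Longrightarrow> smooth_on (\<lambda>x. f x - g x) S"
  using smooth_on_add[of S f "\<lambda>x. (-1) * g x"] smooth_on_mult[of S "\<lambda>x. -1" g] smooth_on_const[of "-1::real" S]
  by simp

lemma smooth_on_prod:
  fixes f :: "'i \<Rightarrow> 'a::real_normed_vector \<Rightarrow> real"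
  shows "open S \<Longrightarrow> (\<And>i. i \<in> I \<Longrightarrow> smooth_on (f i) S) \<Longrightarrow> smooth_on (\<lambda>x. \<Prod>i\<in>I. f i x) S"
  by (induction I rule: infinite_finite_induct) (simp_all add: smooth_on_const smooth_on_mult)

lemma smooth_on_divide:
  fixes f g :: "'a::real_normed_vector \<Rightarrow> real"
  assumes "open S" "smooth_on f S" "smooth_on g S" "\<And>x. x \<in> S \<Longrightarrow> g x \<noteq> 0"
  shows "smooth_on (\<lambda>x. f x / g x) S"
  using assms smooth_on_mult[of S f "\<lambda>x. inverse (g x)"] Ck_on_inverse[of S _ g]
  by (simp add: smooth_on_def divide_inverse)

lemma smooth_on_comp:
  fixes f :: "real^'k::finite \<Rightarrow> real" and g :: "'a::real_normed_vector \<Rightarrow> real^'k"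
  shows "open S \<Longrightarrow> smooth_on f T \<Longrightarrow> smooth_on g S \<Longrightarrow> g ` S \<subseteq> T \<Longrightarrow> smooth_on (\<lambda>x. f (g x)) S"
  unfolding smooth_on_def by (simp add: Ck_on_comp[where T = T and f = f and g = g])

lemma smooth_on_vec_iff:
  fixes f :: "'a::real_normed_vector \<Rightarrow> real^'k::finite"
  assumes "open S"
  shows "smooth_on f S \<longleftrightarrow> (\<forall>l. smooth_on (\<lambda>x. f x $ l) S)"
proof
  assume "smooth_on f S"
  then show "\<forall>l. smooth_on (\<lambda>x. f x $ l) S"
    using smooth_on_comp[OF assms smooth_on_linear[OF bounded_linear_vec_nth], of f] by blast
next
  assume "\<forall>l. smooth_on (\<lambda>x. f x $ l) S"
  then have *: "\<forall>n l. Ck_on n (\<lambda>x. f x $ l) S" by (simp add: smooth_on_def)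
  have "Ck_on n f S" if "\<forall>l. Ck_on n (\<lambda>x. f x $ l) S" for n
    using that
  proof (induction n arbitrary: f)
    case 0
    then show ?case using continuous_on_vec_lambda[of S "\<lambda>l x. f x $ l"] by simp
  next
    case (Suc n)
    have d: "(f has_derivative (\<lambda>v. \<chi> l. frechet_derivative (\<lambda>x. f x $ l) (at x) v)) (at x)"
      if "x \<in> S" for x
      unfolding has_derivative_componentwise_within[of f _ x UNIV]
    proof
      fix b :: "real^'k" assume "b \<in> Basis"
      then obtain l where b: "b = axis l 1" by (auto simp: Basis_vec_def)
      show "((\<lambda>x. f x \<bullet> b) has_derivative (\<lambda>v. (\<chi> l. frechet_derivative (\<lambda>x. f x $ l) (at x) v) \<bullet> b)) (at x)"
        using Ck_on_has_derivative[of n "\<lambda>x. f x $ l" S x] Suc.prems that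
        by (simp add: b inner_axis)
    qed
    show ?case
      by (rule Ck_on_step[OF assms d]) (use Suc in auto)
  qed
  with * show "smooth_on f S" by (simp add: smooth_on_def)
qed

lemma smooth_on_comp_vec:
  fixes f :: "real^'k::finite \<Rightarrow> real^'l::finite" and g :: "'a::real_normed_vector \<Rightarrow> real^'k"
  assumes "open S" "open T" "smooth_on f T" "smooth_on g S" "g ` S \<subseteq> T"
  shows "smooth_on (\<lambda>x. f (g x)) S"
  unfolding smooth_on_vec_iff[OF assms(1)]
proof
  fix l
  have "smooth_on (\<lambda>y. f y $ l) T"
    using assms(3) smooth_on_vec_iff[OF assms(2)] by blast
  then show "smooth_on (\<lambda>x. f (g x) $ l) S"
    using smooth_on_comp[OF assms(1) _ assms(4,5)] by blast
qed

section \<open>Symmetry of second derivatives\<close>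

text \<open>Two applications of the mean value theorem. The left-hand side is symmetric in \<open>v\<close> and \<open>w\<close>, which is
  what forces the second derivative to be symmetric.\<close>

lemma second_difference:
  fixes f :: "'a::real_normed_vector \<Rightarrow> real"
  assumes S: "open S" "smooth_on f S" "ball x r \<subseteq> S" and h: "0 < h" "h * (norm v + norm w) < r"
  shows "\<exists>z\<in>ball x r. f (x + h *\<^sub>R v + h *\<^sub>R w) - f (x + h *\<^sub>R v) - f (x + h *\<^sub>R w) + f x =
     h\<^sup>2 * frechet_derivative (\<lambda>y. frechet_derivative f (at y) v) (at z) w"
proof -
  have inb: "x + s *\<^sub>R v + t *\<^sub>R w \<in> ball x r" if "0 \<le> s" "s \<le> h" "0 \<le> t" "t \<le> h" for s t
  proof -
    have "norm (s *\<^sub>R v + t *\<^sub>R w) \<le> s * norm v + t * norm w"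
      using norm_triangle_ineq[of "s *\<^sub>R v" "t *\<^sub>R w"] that by simp
    also have "\<dots> \<le> h * norm v + h * norm w"
      using that by (intro add_mono mult_right_mono) auto
    also have "\<dots> < r" using h by (simp add: algebra_simps)
    finally show ?thesis by (simp add: dist_norm add.assoc) (metis norm_minus_cancel minus_add_distrib add_uminus_conv_diff)
  qed
  let ?D = "\<lambda>y. frechet_derivative f (at y) v"
  let ?\<phi> = "\<lambda>s. f (x + s *\<^sub>R v + h *\<^sub>R w) - f (x + s *\<^sub>R v + 0 *\<^sub>R w)"
  have line: "((\<lambda>s. g (b + s *\<^sub>R u)) has_real_derivative frechet_derivative g (at (b + s *\<^sub>R u)) u) (at s)"
    if "smooth_on g S" "b + s *\<^sub>R u \<in> S" for g :: "'a \<Rightarrow> real" and b u s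
  proof -
    have d: "(g has_derivative frechet_derivative g (at (b + s *\<^sub>R u))) (at (b + s *\<^sub>R u))"
      by (rule smooth_on_has_derivative[OF that])
    have "((\<lambda>s. b + s *\<^sub>R u) has_derivative (\<lambda>s. s *\<^sub>R u)) (at s)"
      by (auto intro!: derivative_eq_intros)
    from diff_chain_at[OF this d]
    have "((\<lambda>s. g (b + s *\<^sub>R u)) has_derivative (\<lambda>t. frechet_derivative g (at (b + s *\<^sub>R u)) (t *\<^sub>R u))) (at s)"
      by (simp add: o_def)
    moreover have "(\<lambda>t. frechet_derivative g (at (b + s *\<^sub>R u)) (t *\<^sub>R u)) = (\<lambda>t. frechet_derivative g (at (b + s *\<^sub>R u)) u * t)"
      using linear_scale[OF has_derivative_linear[OF d]] by (simp add: fun_eq_iff)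
    ultimately show ?thesis by (simp add: has_field_derivative_def)
  qed
  have "(?\<phi> has_real_derivative ?D (x + s *\<^sub>R v + h *\<^sub>R w) - ?D (x + s *\<^sub>R v + 0 *\<^sub>R w)) (at s)"
    if "0 \<le> s" "s \<le> h" for s
  proof -
    have *: "x + s *\<^sub>R v + t *\<^sub>R w \<in> S" if "t \<in> {0,h}" for t
      using inb[of s t] that \<open>0 \<le> s\<close> \<open>s \<le> h\<close> h S(3) by auto
    then show ?thesis
      using *[of 0] *[of h] line[OF S(2), of "x + h *\<^sub>R w" s v] line[OF S(2), of x s v]
      by (intro DERIV_diff) (simp_all add: add_ac)
  qed
  from MVT2[OF h(1) this]
  obtain s where s: "0 < s" "s < h" "?\<phi> h - ?\<phi> 0 = h * (?D (x + s *\<^sub>R v + h *\<^sub>R w) - ?D (x + s *\<^sub>R v + 0 *\<^sub>R w))"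
    by auto
  have "((\<lambda>t. ?D (x + s *\<^sub>R v + t *\<^sub>R w)) has_real_derivative
      frechet_derivative ?D (at (x + s *\<^sub>R v + t *\<^sub>R w)) w) (at t)" if "0 \<le> t" "t \<le> h" for t
    using line[OF smooth_on_derivative[OF S(2)], of "x + s *\<^sub>R v" t w v] inb[of s t] that s S(3) by auto
  from MVT2[OF h(1) this]
  obtain t where t: "0 < t" "t < h" "?D (x + s *\<^sub>R v + h *\<^sub>R w) - ?D (x + s *\<^sub>R v + 0 *\<^sub>R w) =
      h * frechet_derivative ?D (at (x + s *\<^sub>R v + t *\<^sub>R w)) w"
    by auto
  show ?thesis
    using inb[of s t] s t by (intro bexI[of _ "x + s *\<^sub>R v + t *\<^sub>R w"]) (auto simp: power2_eq_square algebra_simps)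
qed

text \<open>Were the two mixed derivatives different at \<open>x\<close>, then by continuity they would differ at all nearby
  points, whereas the second difference over a small parallelogram is a value of both.\<close>

lemma second_derivative_commute:
  fixes f :: "'a::real_normed_vector \<Rightarrow> real"
  assumes S: "open S" "smooth_on f S" "x \<in> S"
  shows "frechet_derivative (\<lambda>y. frechet_derivative f (at y) v) (at x) w =
    frechet_derivative (\<lambda>y. frechet_derivative f (at y) w) (at x) v"
proof (rule ccontr)
  define D where "D v w x = frechet_derivative (\<lambda>y. frechet_derivative f (at y) v) (at x) w" for v w x
  define e where "e = \<bar>D v w x - D w v x\<bar> / 2"
  assume "\<not> ?thesis"
  then have e: "e > 0" by (simp add: e_def D_def)
  have c: "\<exists>r>0. \<forall>z\<in>ball x r. \<bar>D v w z - D v w x\<bar> < e" for v w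
  proof -
    have "continuous_on S (D v w)"
      unfolding D_def by (intro smooth_on_continuous smooth_on_derivative S)
    then have "isCont (D v w) x" using S by (simp add: continuous_on_eq_continuous_at)
    then show ?thesis
      using e unfolding continuous_at_eps_delta dist_real_def by (metis dist_commute mem_ball)
  qed
  obtain r1 r2 where r: "r1 > 0" "r2 > 0" "\<And>z. z \<in> ball x r1 \<Longrightarrow> \<bar>D v w z - D v w x\<bar> < e"
    "\<And>z. z \<in> ball x r2 \<Longrightarrow> \<bar>D w v z - D w v x\<bar> < e" using c[of v w] c[of w v] by blast
  obtain r3 where r3: "r3 > 0" "ball x r3 \<subseteq> S" using S open_contains_ball by blast
  define r where "r = min r3 (min r1 r2)"
  have rp: "r > 0" "ball x r \<subseteq> S" using r r3 by (auto simp: r_def)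
  \<comment> \<open>Small enough for the parallelogram to stay in the ball; the 1 covers \<open>v = w = 0\<close>.\<close>
  define h where "h = r / (2 * (norm v + norm w + 1))"
  have np: "norm v + norm w + 1 > 0" by (simp add: add_nonneg_pos)
  then have "h > 0" using rp by (simp add: h_def)
  have "h * (norm v + norm w) \<le> h * (norm v + norm w + 1)" using \<open>h > 0\<close> by simp
  also have "\<dots> = r / 2" using np by (simp add: h_def field_simps)
  also have "\<dots> < r" using rp by simp
  finally have hr: "h * (norm v + norm w) < r" .
  obtain z1 where z1: "z1 \<in> ball x r" "f (x + h *\<^sub>R v + h *\<^sub>R w) - f (x + h *\<^sub>R v) - f (x + h *\<^sub>R w) + f x = h\<^sup>2 * D v w z1"
    using second_difference[OF S(1,2) rp(2) \<open>h > 0\<close> hr] by (auto simp: D_def)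
  obtain z2 where z2: "z2 \<in> ball x r" "f (x + h *\<^sub>R w + h *\<^sub>R v) - f (x + h *\<^sub>R w) - f (x + h *\<^sub>R v) + f x = h\<^sup>2 * D w v z2"
    using second_difference[OF S(1,2) rp(2) \<open>h > 0\<close>, of w v] hr by (auto simp: D_def add.commute)
  have "f (x + h *\<^sub>R v + h *\<^sub>R w) = f (x + h *\<^sub>R w + h *\<^sub>R v)" by (simp add: add_ac)
  then have "h\<^sup>2 * D v w z1 = h\<^sup>2 * D w v z2" using z1(2) z2(2) by linarith
  then have "D v w z1 = D w v z2" using \<open>h > 0\<close> by simp
  moreover have "\<bar>D v w z1 - D v w x\<bar> < e" "\<bar>D w v z2 - D w v x\<bar> < e"
    using r(3)[of z1] r(4)[of z2] z1(1) z2(1) by (auto simp: r_def)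
  ultimately have "\<bar>D v w x - D w v x\<bar> < 2 * e" by linarith
  then show False by (simp add: e_def)
qed

section \<open>Partial derivatives\<close>

lemma partial_eqI: "(F has_derivative D) (at x) \<Longrightarrow> partial a F x = D (axis a 1)"
  unfolding partial_def using frechet_derivative_at by metis

lemma partial_cong_open:
  "open S \<Longrightarrow> x \<in> S \<Longrightarrow> (\<And>y. y \<in> S \<Longrightarrow> F y = G y) \<Longrightarrow> partial a F x = partial a G x"
  unfolding partial_def using frechet_derivative_cong_open by metis

lemma smooth_on_partial: "smooth_on F S \<Longrightarrow> smooth_on (partial a F) S"
  using smooth_on_derivative[of F S "axis a 1"] by (simp add: partial_def[abs_def])

lemma partial_commute:
  "open S \<Longrightarrow> smooth_on F S \<Longrightarrow> x \<in> S \<Longrightarrow> partial a (partial b F) x = partial b (partial a F) x"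
  unfolding partial_def[abs_def] by (rule second_derivative_commute)

lemma partial_const [simp]: "partial a (\<lambda>x. c) x = 0"
  by (simp add: partial_def)

lemma partial_add:
  assumes "F differentiable (at x)" "G differentiable (at x)"
  shows "partial a (\<lambda>x. F x + G x) x = partial a F x + partial a G x"
  using partial_eqI[OF has_derivative_add[OF assms[unfolded frechet_derivative_works]]]
  by (simp add: partial_def)

lemma partial_diff:
  assumes "F differentiable (at x)" "G differentiable (at x)"
  shows "partial a (\<lambda>x. F x - G x) x = partial a F x - partial a G x"
  using partial_eqI[OF has_derivative_diff[OF assms[unfolded frechet_derivative_works]]]
  by (simp add: partial_def)

lemma partial_mult:
  assumes "F differentiable (at x)" "G differentiable (at x)"
  shows "partial a (\<lambda>x. F x * G x) x = F x * partial a G x + G x * partial a F x"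
  using partial_eqI[OF has_derivative_mult[OF assms[unfolded frechet_derivative_works]]]
  by (simp add: partial_def)

lemma partial_cmult:
  assumes "F differentiable (at x)"
  shows "partial a (\<lambda>x. c * F x) x = c * partial a F x"
  using partial_mult[OF differentiable_const assms, of a c] by simp

lemma partial_sum:
  assumes "\<And>i. i \<in> I \<Longrightarrow> F i differentiable (at x)"
  shows "partial a (\<lambda>x. \<Sum>i\<in>I. F i x) x = (\<Sum>i\<in>I. partial a (F i) x)"
proof -
  have "((\<lambda>x. \<Sum>i\<in>I. F i x) has_derivative (\<lambda>h. \<Sum>i\<in>I. frechet_derivative (F i) (at x) h)) (at x)"
    using assms by (intro has_derivative_sum) (simp add: frechet_derivative_works)
  from partial_eqI[OF this] show ?thesis by (simp add: partial_def)
qed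

section \<open>Inverse matrices\<close>

lemma smooth_on_det:
  fixes A :: "'a::real_normed_vector \<Rightarrow> real^'n^'n"
  assumes "open S" "\<And>i j. smooth_on (\<lambda>x. A x $ i $ j) S"
  shows "smooth_on (\<lambda>x. det (A x)) S"
  unfolding det_def
  by (intro smooth_on_sum smooth_on_mult smooth_on_prod smooth_on_const assms)

lemma matrix_inv_inverse:
  fixes A :: "real^'n^'n"
  assumes "invertible A"
  shows "A ** matrix_inv A = mat 1" "matrix_inv A ** A = mat 1"
  using someI_ex[OF assms[unfolded invertible_def]] by (simp_all add: matrix_inv_def)

text \<open>Cramer's rule makes the entries of the inverse rational functions of the entries of the matrix, hence
  smooth functions of a parameter.\<close>

lemma matrix_inv_cramer:
  fixes A :: "real^'n^'n"
  assumes "invertible A"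
  shows "matrix_inv A $ k $ l = det (\<chi> i j. if j = k then axis l 1 $ i else A $ i $ j) / det A"
proof -
  have "det A \<noteq> 0" using assms invertible_det_nz by blast
  moreover have "A *v (matrix_inv A *v axis l 1) = axis l 1"
    by (simp add: matrix_vector_mul_assoc matrix_inv_inverse[OF assms])
  ultimately have "matrix_inv A *v axis l 1 = (\<chi> k. det (\<chi> i j. if j = k then axis l 1 $ i else A $ i $ j) / det A)"
    using cramer by blast
  moreover have "matrix_inv A $ k $ l = (matrix_inv A *v axis l 1) $ k"
    by (simp add: matrix_vector_mul_component inner_axis)
  ultimately show ?thesis by simp
qed

lemma smooth_on_matrix_inv:
  fixes A :: "'a::real_normed_vector \<Rightarrow> real^'n^'n"
  assumes S: "open S" "\<And>i j. smooth_on (\<lambda>x. A x $ i $ j) S" and inv: "\<And>x. x \<in> S \<Longrightarrow> invertible (A x)"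
  shows "smooth_on (\<lambda>x. matrix_inv (A x) $ k $ l) S"
proof (rule smooth_on_cong[OF S(1)])
  show "smooth_on (\<lambda>x. det (\<chi> i j. if j = k then axis l 1 $ i else A x $ i $ j) / det (A x)) S"
  proof (intro smooth_on_divide S smooth_on_det)
    show "smooth_on (\<lambda>x. (\<chi> i j. if j = k then axis l 1 $ i else A x $ i $ j) $ i $ j) S" for i j
      using S by (cases "j = k") (simp_all add: smooth_on_const)
  qed (use inv invertible_det_nz in auto)
qed (simp add: matrix_inv_cramer inv)

section \<open>Second-order differential operators\<close>

text \<open>Operators without a zeroth-order term. The Laplacian in a chart is of this form, and the algebra below
  uses nothing else about it; the first-order part is subtracted to match the sign of the Christoffel
  term.\<close>

definition second_order_op ::
  "('m \<Rightarrow> 'm \<Rightarrow> real^'m \<Rightarrow> real) \<Rightarrow> ('m \<Rightarrow> real^'m \<Rightarrow> real) \<Rightarrow> (real^'m::finite \<Rightarrow> real) \<Rightarrow> real^'m \<Rightarrow> real" where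
  "second_order_op A B F x =
     (\<Sum>a\<in>UNIV. \<Sum>b\<in>UNIV. A a b x * partial a (partial b F) x) - (\<Sum>c\<in>UNIV. B c x * partial c F x)"

text \<open>When \<open>A\<close> is the inverse metric, this is the inner product of the two gradients. It is the
  carre du champ of the operator with principal part \<open>A\<close>.\<close>

definition grad_prod ::
  "('m \<Rightarrow> 'm \<Rightarrow> real^'m \<Rightarrow> real) \<Rightarrow> (real^'m::finite \<Rightarrow> real) \<Rightarrow> (real^'m \<Rightarrow> real) \<Rightarrow> real^'m \<Rightarrow> real" where
  "grad_prod A F G x = (\<Sum>a\<in>UNIV. \<Sum>b\<in>UNIV. A a b x * (partial a F x * partial b G x))"

lemma second_order_op_cong_open:
  assumes "open S" "x \<in> S" "\<And>y. y \<in> S \<Longrightarrow> F y = G y"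
  shows "second_order_op A B F x = second_order_op A B G x"
proof -
  have *: "partial c F y = partial c G y" if "y \<in> S" for c y
    using partial_cong_open[OF assms(1) that assms(3)] .
  then have "partial a (partial b F) x = partial a (partial b G) x" for a b
    using partial_cong_open[OF assms(1,2), of "partial b F" "partial b G"] by blast
  with * assms(2) show ?thesis by (simp add: second_order_op_def)
qed

lemma second_order_op_const:
  fixes x :: "real^'m::finite"
  shows "second_order_op A B (\<lambda>x. c) x = 0"
proof -
  have "partial b (\<lambda>x::real^'m. c) = (\<lambda>x. 0)" for b by (rule ext) simp
  then show ?thesis by (simp add: second_order_op_def)
qed

lemma partial_partial_add:
  assumes S: "open S" "smooth_on F S" "smooth_on G S" "x \<in> S"
  shows "partial a (partial b (\<lambda>x. F x + G x)) x = partial a (partial b F) x + partial a (partial b G) x"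
proof -
  have "partial a (partial b (\<lambda>x. F x + G x)) x = partial a (\<lambda>x. partial b F x + partial b G x) x"
    by (rule partial_cong_open[OF S(1,4)]) (intro partial_add smooth_on_differentiable[OF S(2)] smooth_on_differentiable[OF S(3)])
  also have "\<dots> = partial a (partial b F) x + partial a (partial b G) x"
    using smooth_on_partial[OF S(2)] smooth_on_partial[OF S(3)] S(4)
    by (intro partial_add smooth_on_differentiable) auto
  finally show ?thesis .
qed

lemma partial_partial_mult:
  assumes S: "open S" "smooth_on F S" "smooth_on G S" "x \<in> S"
  shows "partial a (partial b (\<lambda>x. F x * G x)) x =
    F x * partial a (partial b G) x + G x * partial a (partial b F) x
    + partial a F x * partial b G x + partial b F x * partial a G x"
proof -
  note d = smooth_on_differentiable[OF S(2)] smooth_on_differentiable[OF S(3)]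
    smooth_on_differentiable[OF smooth_on_partial[OF S(2)]] smooth_on_differentiable[OF smooth_on_partial[OF S(3)]]
  have "partial a (partial b (\<lambda>x. F x * G x)) x = partial a (\<lambda>x. F x * partial b G x + G x * partial b F x) x"
    by (rule partial_cong_open[OF S(1,4)]) (intro partial_mult d)
  also have "\<dots> = partial a (\<lambda>x. F x * partial b G x) x + partial a (\<lambda>x. G x * partial b F x) x"
    by (intro partial_add differentiable_mult d S)
  also have "\<dots> = F x * partial a (partial b G) x + partial b G x * partial a F x
     + (G x * partial a (partial b F) x + partial b F x * partial a G x)"
    using S(4) by (simp add: partial_mult d)
  finally show ?thesis by simp
qed

lemma second_order_op_add:
  assumes S: "open S" "smooth_on F S" "smooth_on G S" "x \<in> S"
  shows "second_order_op A B (\<lambda>x. F x + G x) x = second_order_op A B F x + second_order_op A B G x"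
  using partial_partial_add[OF S] partial_add[OF smooth_on_differentiable[OF S(2,4)] smooth_on_differentiable[OF S(3,4)]]
  by (simp add: second_order_op_def sum.distrib algebra_simps)

lemma second_order_op_mult:
  assumes S: "open S" "smooth_on F S" "smooth_on G S" "x \<in> S" and sym: "\<And>a b. A a b x = A b a x"
  shows "second_order_op A B (\<lambda>x. F x * G x) x =
    F x * second_order_op A B G x + G x * second_order_op A B F x + 2 * grad_prod A F G x"
proof -
  have "(\<Sum>a\<in>UNIV. \<Sum>b\<in>UNIV. A a b x * (partial b F x * partial a G x)) = grad_prod A F G x"
    unfolding grad_prod_def by (subst sum.swap) (simp add: sym)
  then show ?thesis
    using partial_partial_mult[OF S] partial_mult[OF smooth_on_differentiable[OF S(2,4)] smooth_on_differentiable[OF S(3,4)]]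
    by (simp add: second_order_op_def grad_prod_def sum.distrib sum_distrib_left algebra_simps)
qed

lemma second_order_op_cmult:
  assumes S: "open S" "smooth_on F S" "x \<in> S"
  shows "second_order_op A B (\<lambda>x. c * F x) x = c * second_order_op A B F x"
proof -
  have "partial a (partial b (\<lambda>x. c * F x)) x = c * partial a (partial b F) x" for a b
    using partial_partial_mult[OF S(1) smooth_on_const S(2,3), of a b c] 
    by (simp add: partial_cong_open[OF S(1,3), of "partial b (\<lambda>x. c)" "\<lambda>x. 0"])
  then show ?thesis
    by (simp add: second_order_op_def partial_cmult smooth_on_differentiable[OF S(2,3)] sum_distrib_left algebra_simps)
qed

lemma second_order_op_diff:
  assumes S: "open S" "smooth_on F S" "smooth_on G S" "x \<in> S"
  shows "second_order_op A B (\<lambda>x. F x - G x) x = second_order_op A B F x - second_order_op A B G x"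
proof -
  have "smooth_on (\<lambda>x. (-1) * G x) S" by (intro smooth_on_mult S smooth_on_const)
  from second_order_op_add[OF S(1,2) this S(4)] second_order_op_cmult[OF S(1,3,4), of A B "-1"]
  show ?thesis by simp
qed

lemma second_order_op_sum:
  assumes S: "open S" "\<And>i. i \<in> I \<Longrightarrow> smooth_on (F i) S" "x \<in> S"
  shows "second_order_op A B (\<lambda>x. \<Sum>i\<in>I. F i x) x = (\<Sum>i\<in>I. second_order_op A B (F i) x)"
  using S(2)
proof (induction I rule: infinite_finite_induct)
  case (insert i I)
  have "smooth_on (\<lambda>x. \<Sum>i\<in>I. F i x) S" using insert.prems by (intro smooth_on_sum S(1)) auto
  then have "second_order_op A B (\<lambda>x. F i x + (\<Sum>i\<in>I. F i x)) x
      = second_order_op A B (F i) x + second_order_op A B (\<lambda>x. \<Sum>i\<in>I. F i x) x"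
    using insert.prems by (intro second_order_op_add[OF S(1) _ _ S(3)]) auto
  then show ?case using insert by simp
qed (simp_all add: second_order_op_const)

lemma smooth_on_second_order_op:
  assumes "open S" "\<And>a b. smooth_on (A a b) S" "\<And>c. smooth_on (B c) S" "smooth_on F S"
  shows "smooth_on (second_order_op A B F) S"
  unfolding second_order_op_def[abs_def]
  by (intro smooth_on_diff smooth_on_sum smooth_on_mult smooth_on_partial assms)

lemma smooth_on_grad_prod:
  assumes "open S" "\<And>a b. smooth_on (A a b) S" "smooth_on F S" "smooth_on G S"
  shows "smooth_on (grad_prod A F G) S"
  unfolding grad_prod_def[abs_def]
  by (intro smooth_on_sum smooth_on_mult smooth_on_partial assms)

lemma grad_prod_commute:
  assumes "\<And>a b. A a b x = A b a x"
  shows "grad_prod A F G x = grad_prod A G F x"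
  unfolding grad_prod_def by (subst sum.swap) (simp add: assms[of _ ] mult_ac cong: sum.cong)

lemma grad_prod_mult_left:
  assumes "F differentiable (at x)" "G differentiable (at x)"
  shows "grad_prod A (\<lambda>x. F x * G x) H x = F x * grad_prod A G H x + G x * grad_prod A F H x"
  by (simp add: grad_prod_def partial_mult[OF assms] sum.distrib sum_distrib_left algebra_simps)

text \<open>Up to a constant, the fully symmetrized square of the principal symbol: a second-order operator
  applied twice to a product of four functions vanishing at \<open>x\<close> must spend one derivative on each
  factor, and the three terms are the ways of pairing the factors.\<close>

lemma second_order_op_square_quartic:
  assumes S: "open S" "x \<in> S" and A: "\<And>a b. smooth_on (A a b) S" "\<And>a b y. y \<in> S \<Longrightarrow> A a b y = A b a y"
    and B: "\<And>c. smooth_on (B c) S"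
    and F: "smooth_on F1 S" "smooth_on F2 S" "smooth_on F3 S" "smooth_on F4 S"
    and zero: "F1 x = 0" "F2 x = 0" "F3 x = 0" "F4 x = 0"
  shows "second_order_op A B (second_order_op A B (\<lambda>y. F1 y * F2 y * (F3 y * F4 y))) x =
    8 * (grad_prod A F1 F2 x * grad_prod A F3 F4 x + grad_prod A F1 F3 x * grad_prod A F2 F4 x
       + grad_prod A F1 F4 x * grad_prod A F2 F3 x)"
proof -
  let ?L = "second_order_op A B" and ?G = "grad_prod A"
  note sm = smooth_on_mult smooth_on_const smooth_on_second_order_op smooth_on_grad_prod
  have Lmult: "?L (\<lambda>y. P y * Q y) y = P y * ?L Q y + Q y * ?L P y + 2 * ?G P Q y"
    if "smooth_on P S" "smooth_on Q S" "y \<in> S" for P Q y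
    by (rule second_order_op_mult[OF S(1) that]) (rule A(2)[OF that(3)])
  \<comment> \<open>A product of two functions vanishing at \<open>x\<close> vanishes there to second order, so a third factor
    is not differentiated.\<close>
  have vanish: "?L (\<lambda>y. P y * Q y * H y) x = H x * (2 * ?G P Q x)"
    if "smooth_on P S" "smooth_on Q S" "smooth_on H S" "P x = 0" "Q x = 0" for P Q H
  proof -
    have PQ: "smooth_on (\<lambda>y. P y * Q y) S" by (intro sm S that)
    have "?G (\<lambda>y. P y * Q y) H x = 0"
      using that S by (subst grad_prod_mult_left) (auto intro: smooth_on_differentiable)
    moreover have "?L (\<lambda>y. P y * Q y) x = 2 * ?G P Q x"
      using that Lmult[OF that(1,2) S(2)] by simp
    ultimately show ?thesis
      using Lmult[OF PQ that(3) S(2)] that by simp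
  qed
  \<comment> \<open>Apply the product rule once to \<open>P Q\<close>; then every term is a product of two functions
    vanishing at \<open>x\<close> and a smooth factor.\<close>
  let ?P = "\<lambda>y. F1 y * F2 y" and ?Q = "\<lambda>y. F3 y * F4 y"
  have PQ: "smooth_on ?P S" "smooth_on ?Q S" by (intro sm S F)+
  have LPQ: "smooth_on (?L ?P) S" "smooth_on (?L ?Q) S" by (intro sm S A B PQ)+
  have G: "smooth_on (?G F G) S" if "smooth_on F S" "smooth_on G S" for F G by (intro sm S A that)
  have GPQ: "?G ?P ?Q y = F1 y * F3 y * ?G F2 F4 y + (F1 y * F4 y * ?G F2 F3 y
      + (F2 y * F3 y * ?G F1 F4 y + F2 y * F4 y * ?G F1 F3 y))" if y: "y \<in> S" for y
  proof -
    have c: "?G F G y = ?G G F y" for F G using grad_prod_commute A(2)[OF y] .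
    have l: "?G H ?Q y = F3 y * ?G H F4 y + F4 y * ?G H F3 y" for H
      using grad_prod_mult_left[OF smooth_on_differentiable[OF F(3) y] smooth_on_differentiable[OF F(4) y], of A H] c by metis
    show ?thesis
      using grad_prod_mult_left[OF smooth_on_differentiable[OF F(1) y] smooth_on_differentiable[OF F(2) y], of A ?Q]
      by (simp add: l algebra_simps)
  qed
  have "?L (?L (\<lambda>y. ?P y * ?Q y)) x = ?L (\<lambda>y. (?P y * ?L ?Q y + ?Q y * ?L ?P y) + 2 * 
     (F1 y * F3 y * ?G F2 F4 y + (F1 y * F4 y * ?G F2 F3 y
      + (F2 y * F3 y * ?G F1 F4 y + F2 y * F4 y * ?G F1 F3 y)))) x"
    by (rule second_order_op_cong_open[OF S]) (simp add: Lmult[OF PQ] GPQ)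
  also have "\<dots> = (?L (\<lambda>y. ?P y * ?L ?Q y) x + ?L (\<lambda>y. ?Q y * ?L ?P y) x) + 2 * 
     (?L (\<lambda>y. F1 y * F3 y * ?G F2 F4 y) x + (?L (\<lambda>y. F1 y * F4 y * ?G F2 F3 y) x
      + (?L (\<lambda>y. F2 y * F3 y * ?G F1 F4 y) x + ?L (\<lambda>y. F2 y * F4 y * ?G F1 F3 y) x)))"
    by (simp add: second_order_op_add[OF S(1) _ _ S(2)] second_order_op_cmult[OF S(1) _ S(2)]
        smooth_on_add[OF S(1)] smooth_on_mult[OF S(1)] smooth_on_const F LPQ G)
  also have "\<dots> = ?L ?Q x * (2 * ?G F1 F2 x) + ?L ?P x * (2 * ?G F3 F4 x) + 2 *
      (?G F2 F4 x * (2 * ?G F1 F3 x) + (?G F2 F3 x * (2 * ?G F1 F4 x)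
      + (?G F1 F4 x * (2 * ?G F2 F3 x) + ?G F1 F3 x * (2 * ?G F2 F4 x))))"
    using vanish[OF F(1,2) LPQ(2)] vanish[OF F(3,4) LPQ(1)] vanish[OF F(1,3) G[OF F(2,4)]]
      vanish[OF F(1,4) G[OF F(2,3)]] vanish[OF F(2,3) G[OF F(1,4)]] vanish[OF F(2,4) G[OF F(1,3)]] zero by simp
  also have "?L ?P x = 2 * ?G F1 F2 x"
    by (simp add: Lmult[OF F(1,2) S(2)] zero)
  also have "?L ?Q x = 2 * ?G F3 F4 x"
    by (simp add: Lmult[OF F(3,4) S(2)] zero)
  finally show ?thesis by (simp add: algebra_simps)
qed

section \<open>Slices of a product of coordinate spaces\<close>

lemma left_join [simp]: "left_vec (join_vec u v) = u"
  by (simp add: left_vec_def join_vec_def)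

lemma right_join [simp]: "right_vec (join_vec u v) = v"
  by (simp add: right_vec_def join_vec_def)

lemma join_left_right [simp]: "join_vec (left_vec w) (right_vec w) = w"
  by (auto simp: left_vec_def right_vec_def join_vec_def vec_eq_iff split: sum.split)

lemma join_vec_nth [simp]: "join_vec u v $ Inl a = u $ a" "join_vec u v $ Inr c = v $ c"
  by (simp_all add: join_vec_def)

lemma join_vec_eq_iff: "join_vec u v = join_vec u' v' \<longleftrightarrow> u = u' \<and> v = v'"
  by (metis left_join right_join)

lemma linear_left_vec: "linear left_vec" and linear_right_vec: "linear right_vec"
  by (auto intro!: linearI simp: left_vec_def right_vec_def vec_eq_iff)

lemma linear_join: "linear (\<lambda>z. join_vec (fst z) (snd z))"
  by (auto intro!: linearI simp: join_vec_def vec_eq_iff split: sum.split)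

lemma bounded_linear_left_vec: "bounded_linear left_vec" and bounded_linear_right_vec: "bounded_linear right_vec"
  using linear_left_vec linear_right_vec linear_conv_bounded_linear by blast+

lemma bounded_linear_join: "bounded_linear (\<lambda>z. join_vec (fst z) (snd z))"
  using linear_join linear_conv_bounded_linear by blast

lemma left_right_axis [simp]: "left_vec (axis (Inl a) 1) = axis a 1" "left_vec (axis (Inr c) 1) = 0"
  "right_vec (axis (Inl a) 1) = 0" "right_vec (axis (Inr c) 1) = axis c 1"
  by (auto simp: left_vec_def right_vec_def vec_eq_iff axis_def)

lemma join_axis: "join_vec (axis a 1) 0 = axis (Inl a) 1" "join_vec 0 (axis c 1) = axis (Inr c) 1"
  by (auto simp: join_vec_def vec_eq_iff axis_def split: sum.split)

lemma has_derivative_join_left: "((\<lambda>x. join_vec x y) has_derivative (\<lambda>h. join_vec h 0)) (at x)"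
proof -
  have "((\<lambda>x. (x, y)) has_derivative (\<lambda>h. (h, 0))) (at x)" by (auto intro!: derivative_eq_intros)
  from bounded_linear.has_derivative[OF bounded_linear_join this] show ?thesis by simp
qed

lemma has_derivative_join_right: "((\<lambda>y. join_vec x y) has_derivative (\<lambda>h. join_vec 0 h)) (at y)"
proof -
  have "((\<lambda>y. (x, y)) has_derivative (\<lambda>h. (0, h))) (at y)" by (auto intro!: derivative_eq_intros)
  from bounded_linear.has_derivative[OF bounded_linear_join this] show ?thesis by simp
qed

lemma partial_slice_left:
  assumes "F differentiable (at (join_vec x y))"
  shows "partial a (\<lambda>x. F (join_vec x y)) x = partial (Inl a) F (join_vec x y)"
  using partial_eqI[OF diff_chain_at[OF has_derivative_join_left assms[unfolded frechet_derivative_works], unfolded o_def]]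
  by (simp add: partial_def join_axis)

lemma partial_slice_right:
  assumes "F differentiable (at (join_vec x y))"
  shows "partial c (\<lambda>y. F (join_vec x y)) y = partial (Inr c) F (join_vec x y)"
  using partial_eqI[OF diff_chain_at[OF has_derivative_join_right assms[unfolded frechet_derivative_works], unfolded o_def]]
  by (simp add: partial_def join_axis)

lemma partial_comp_left:
  assumes "F differentiable (at (left_vec w))"
  shows "partial d (\<lambda>w. F (left_vec w)) w = (case d of Inl a \<Rightarrow> partial a F (left_vec w) | Inr c \<Rightarrow> 0)"
proof -
  have "linear (frechet_derivative F (at (left_vec w)))"
    using assms frechet_derivative_works has_derivative_linear by blast
  then show ?thesis
    using partial_eqI[OF diff_chain_at[OF bounded_linear_imp_has_derivative[OF bounded_linear_left_vec]
      assms[unfolded frechet_derivative_works], unfolded o_def], of d]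
    by (auto simp: partial_def linear_0 split: sum.split)
qed

lemma partial_comp_right:
  assumes "F differentiable (at (right_vec w))"
  shows "partial d (\<lambda>w. F (right_vec w)) w = (case d of Inl a \<Rightarrow> 0 | Inr c \<Rightarrow> partial c F (right_vec w))"
proof -
  have "linear (frechet_derivative F (at (right_vec w)))"
    using assms frechet_derivative_works has_derivative_linear by blast
  then show ?thesis
    using partial_eqI[OF diff_chain_at[OF bounded_linear_imp_has_derivative[OF bounded_linear_right_vec]
      assms[unfolded frechet_derivative_works], unfolded o_def], of d]
    by (auto simp: partial_def linear_0 split: sum.split)
qed

lemma open_slice_left: "open S \<Longrightarrow> open {x. join_vec x y \<in> S}"
  and open_slice_right: "open S \<Longrightarrow> open {y. join_vec x y \<in> S}"
proof -
  have "continuous_on UNIV (\<lambda>x. join_vec x y)"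
    by (auto intro!: continuous_at_imp_continuous_on has_derivative_continuous[OF has_derivative_join_left])
  moreover have "continuous_on UNIV (\<lambda>y. join_vec x y)"
    by (auto intro!: continuous_at_imp_continuous_on has_derivative_continuous[OF has_derivative_join_right])
  ultimately show "open S \<Longrightarrow> open {x. join_vec x y \<in> S}" "open S \<Longrightarrow> open {y. join_vec x y \<in> S}"
    using open_vimage by (force simp: vimage_def)+
qed

lemma smooth_on_join:
  fixes F :: "'a::real_normed_vector \<Rightarrow> real^'m::finite" and G :: "'a \<Rightarrow> real^'n::finite"
  assumes "open S" "smooth_on F S" "smooth_on G S"
  shows "smooth_on (\<lambda>x. join_vec (F x) (G x)) S"
  unfolding smooth_on_vec_iff[OF assms(1)]
proof
  fix l :: "'m + 'n"
  show "smooth_on (\<lambda>x. join_vec (F x) (G x) $ l) S"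
    using assms by (cases l) (simp_all add: smooth_on_vec_iff)
qed

lemma smooth_on_slice_left:
  fixes F :: "real^('m::finite + 'n::finite) \<Rightarrow> real"
  assumes "open S" "smooth_on F S"
  shows "smooth_on (\<lambda>x. F (join_vec x y)) {x. join_vec x y \<in> S}"
  by (rule smooth_on_comp[OF open_slice_left[OF assms(1)] assms(2),
      where g = "\<lambda>x. join_vec x y", OF smooth_on_join[OF open_slice_left[OF assms(1)]]])
    (auto intro: smooth_on_const smooth_on_linear bounded_linear_ident)

lemma smooth_on_slice_right:
  fixes F :: "real^('m::finite + 'n::finite) \<Rightarrow> real"
  assumes "open S" "smooth_on F S"
  shows "smooth_on (\<lambda>y. F (join_vec x y)) {y. join_vec x y \<in> S}"
  by (rule smooth_on_comp[OF open_slice_right[OF assms(1)] assms(2),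
      where g = "\<lambda>y. join_vec x y", OF smooth_on_join[OF open_slice_right[OF assms(1)]]])
    (auto intro: smooth_on_const smooth_on_linear bounded_linear_ident)

lemma partial_partial_slice_left:
  assumes "open S" "smooth_on F S" "join_vec x y \<in> S"
  shows "partial a (partial b (\<lambda>x. F (join_vec x y))) x = partial (Inl a) (partial (Inl b) F) (join_vec x y)"
proof -
  have "partial a (partial b (\<lambda>x. F (join_vec x y))) x = partial a (\<lambda>x. partial (Inl b) F (join_vec x y)) x"
    using assms(3) by (intro partial_cong_open[OF open_slice_left[OF assms(1)]])
      (auto intro: partial_slice_left smooth_on_differentiable[OF assms(2)])
  also have "\<dots> = partial (Inl a) (partial (Inl b) F) (join_vec x y)"
    by (rule partial_slice_left) (rule smooth_on_differentiable[OF smooth_on_partial[OF assms(2)] assms(3)])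
  finally show ?thesis .
qed

lemma partial_partial_slice_right:
  assumes "open S" "smooth_on F S" "join_vec x y \<in> S"
  shows "partial a (partial b (\<lambda>y. F (join_vec x y))) y = partial (Inr a) (partial (Inr b) F) (join_vec x y)"
proof -
  have "partial a (partial b (\<lambda>y. F (join_vec x y))) y = partial a (\<lambda>y. partial (Inr b) F (join_vec x y)) y"
    using assms(3) by (intro partial_cong_open[OF open_slice_right[OF assms(1)]])
      (auto intro: partial_slice_right smooth_on_differentiable[OF assms(2)])
  also have "\<dots> = partial (Inr a) (partial (Inr b) F) (join_vec x y)"
    by (rule partial_slice_right) (rule smooth_on_differentiable[OF smooth_on_partial[OF assms(2)] assms(3)])
  finally show ?thesis .
qed

lemma second_order_op_slice_left:
  assumes "open S" "smooth_on F S" "join_vec x y \<in> S"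
  shows "second_order_op A B (\<lambda>x. F (join_vec x y)) x =
    (\<Sum>a\<in>UNIV. \<Sum>b\<in>UNIV. A a b x * partial (Inl a) (partial (Inl b) F) (join_vec x y))
    - (\<Sum>c\<in>UNIV. B c x * partial (Inl c) F (join_vec x y))"
  by (simp add: second_order_op_def partial_partial_slice_left[OF assms]
      partial_slice_left[OF smooth_on_differentiable[OF assms(2,3)]])

lemma second_order_op_slice_right:
  assumes "open S" "smooth_on F S" "join_vec x y \<in> S"
  shows "second_order_op A B (\<lambda>y. F (join_vec x y)) y =
    (\<Sum>a\<in>UNIV. \<Sum>b\<in>UNIV. A a b y * partial (Inr a) (partial (Inr b) F) (join_vec x y))
    - (\<Sum>c\<in>UNIV. B c y * partial (Inr c) F (join_vec x y))"
  by (simp add: second_order_op_def partial_partial_slice_right[OF assms]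
      partial_slice_right[OF smooth_on_differentiable[OF assms(2,3)]])

section \<open>Commuting operators in separate variables\<close>

text \<open>The coefficients \<open>A\<close>, \<open>B\<close> are evaluated at \<open>x\<close> only, so they are constants for a derivative in
  \<open>y\<close>; what is left is the symmetry of the mixed partial derivatives of \<open>F\<close>.\<close>

lemma partial_second_order_op_slice:
  assumes S: "open S" "smooth_on F S" "join_vec x y \<in> S"
  shows "partial c (\<lambda>y. second_order_op A B (\<lambda>x. F (join_vec x y)) x) y
    = second_order_op A B (\<lambda>x. partial (Inr c) F (join_vec x y)) x"
proof -
  note d = smooth_on_differentiable[OF smooth_on_slice_right[OF S(1)], of _ y x, simplified, OF _ S(3)]
  note sp = smooth_on_partial
  have com3: "partial (Inr c) (partial (Inl a) (partial (Inl b) F)) (join_vec x y)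
     = partial (Inl a) (partial (Inl b) (partial (Inr c) F)) (join_vec x y)" for a b
  proof -
    have "partial (Inr c) (partial (Inl a) (partial (Inl b) F)) (join_vec x y)
       = partial (Inl a) (partial (Inr c) (partial (Inl b) F)) (join_vec x y)"
      by (intro partial_commute[OF S(1)] sp S)
    also have "\<dots> = partial (Inl a) (partial (Inl b) (partial (Inr c) F)) (join_vec x y)"
      by (rule partial_cong_open[OF S(1,3)]) (intro partial_commute[OF S(1)] S)
    finally show ?thesis .
  qed
  have "partial c (\<lambda>y. second_order_op A B (\<lambda>x. F (join_vec x y)) x) y = partial c (\<lambda>y.
    (\<Sum>a\<in>UNIV. \<Sum>b\<in>UNIV. A a b x * partial (Inl a) (partial (Inl b) F) (join_vec x y))
    - (\<Sum>e\<in>UNIV. B e x * partial (Inl e) F (join_vec x y))) y"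
    using S(3) by (intro partial_cong_open[OF open_slice_right[OF S(1), of x]]) (auto simp: second_order_op_slice_left[OF S(1,2)])
  also have "\<dots> = (\<Sum>a\<in>UNIV. \<Sum>b\<in>UNIV. A a b x * partial c (\<lambda>y. partial (Inl a) (partial (Inl b) F) (join_vec x y)) y)
    - (\<Sum>e\<in>UNIV. B e x * partial c (\<lambda>y. partial (Inl e) F (join_vec x y)) y)"
  proof -
    have d2: "(\<lambda>y. partial (Inl a) (partial (Inl b) F) (join_vec x y)) differentiable (at y)" for a b
      by (intro d sp S)
    have d1: "(\<lambda>y. partial (Inl a) F (join_vec x y)) differentiable (at y)" for a by (intro d sp S)
    show ?thesis
      by (simp add: partial_diff partial_sum partial_cmult d1 d2)
  qed
  also have "\<dots> = second_order_op A B (\<lambda>x. partial (Inr c) F (join_vec x y)) x"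
    by (simp add: second_order_op_slice_left[OF S(1) sp[OF S(2)] S(3)] com3
      partial_slice_right smooth_on_differentiable[OF sp[OF sp[OF S(2)]] S(3)] smooth_on_differentiable[OF sp[OF S(2)] S(3)]
      partial_commute[OF S, of "Inr c"])
  finally show ?thesis .
qed

text \<open>The second operator is a combination of derivatives in \<open>y\<close>, each of which passes through the
  first operator, with coefficients that depend on \<open>y\<close> alone and so are constants for the first
  operator.\<close>

lemma second_order_op_slices_commute:
  assumes S: "open S" "smooth_on F S" "join_vec x y \<in> S"
  shows "second_order_op A' B' (\<lambda>y. second_order_op A B (\<lambda>x. F (join_vec x y)) x) y
    = second_order_op A B (\<lambda>x. second_order_op A' B' (\<lambda>y. F (join_vec x y)) y) x"
proof -
  note sp = smooth_on_partial
  let ?L = "second_order_op A B"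
  have oy: "open {y. join_vec x y \<in> S}" and ox: "open {x. join_vec x y \<in> S}"
    by (intro open_slice_left open_slice_right S)+
  have p2: "partial a (partial b (\<lambda>y. ?L (\<lambda>x. F (join_vec x y)) x)) y
     = ?L (\<lambda>x. partial (Inr a) (partial (Inr b) F) (join_vec x y)) x" for a b
  proof -
    have "partial a (partial b (\<lambda>y. ?L (\<lambda>x. F (join_vec x y)) x)) y
      = partial a (\<lambda>y. ?L (\<lambda>x. partial (Inr b) F (join_vec x y)) x) y"
      using S by (intro partial_cong_open[OF oy]) (auto intro: partial_second_order_op_slice)
    then show ?thesis using partial_second_order_op_slice[OF S(1) sp[OF S(2)] S(3)] by simp
  qed
  note s = smooth_on_slice_left[OF S(1), of _ y]
  have "?L (\<lambda>x. second_order_op A' B' (\<lambda>y. F (join_vec x y)) y) x = ?L (\<lambda>x.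
    (\<Sum>a\<in>UNIV. \<Sum>b\<in>UNIV. A' a b y * partial (Inr a) (partial (Inr b) F) (join_vec x y))
    - (\<Sum>c\<in>UNIV. B' c y * partial (Inr c) F (join_vec x y))) x"
    using S(3) by (intro second_order_op_cong_open[OF ox]) (auto simp: second_order_op_slice_right[OF S(1,2)])
  also have "\<dots> = (\<Sum>a\<in>UNIV. \<Sum>b\<in>UNIV. A' a b y * ?L (\<lambda>x. partial (Inr a) (partial (Inr b) F) (join_vec x y)) x)
    - (\<Sum>c\<in>UNIV. B' c y * ?L (\<lambda>x. partial (Inr c) F (join_vec x y)) x)"
  proof -
    have x: "x \<in> {x. join_vec x y \<in> S}" using S(3) by simp
    have s2: "smooth_on (\<lambda>x. partial (Inr a) (partial (Inr b) F) (join_vec x y)) {x. join_vec x y \<in> S}" for a b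
      by (intro s sp S)
    have s1: "smooth_on (\<lambda>x. partial (Inr b) F (join_vec x y)) {x. join_vec x y \<in> S}" for b
      by (intro s sp S)
    note sm = smooth_on_sum[OF ox] smooth_on_mult[OF ox] smooth_on_const s1 s2
    have t2: "smooth_on (\<lambda>x. A' a b y * partial (Inr a) (partial (Inr b) F) (join_vec x y)) {x. join_vec x y \<in> S}" for a b
      by (intro sm)
    have t1: "smooth_on (\<lambda>x. B' b y * partial (Inr b) F (join_vec x y)) {x. join_vec x y \<in> S}" for b
      by (intro sm)
    show ?thesis
      by (simp add: second_order_op_diff[OF ox _ _ x] second_order_op_sum[OF ox _ x] second_order_op_cmult[OF ox _ x]
        s1 s2 t1 t2 smooth_on_sum[OF ox])
  qed
  also have "\<dots> = second_order_op A' B' (\<lambda>y. ?L (\<lambda>x. F (join_vec x y)) x) y"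
    by (simp add: second_order_op_def[of A' B'] p2 partial_second_order_op_slice[OF S])
  finally show ?thesis by simp
qed

section \<open>Charts\<close>

lemma atlas_cover: "smooth_atlas M \<Longrightarrow> (\<Union>i\<in>index M. dom M i) = points M"
  by (simp add: smooth_atlas_def)

lemma atlas_chart:
  assumes "smooth_atlas M" "i \<in> index M"
  shows "openin (carrier_top M) (dom M i)" "open (chart M i ` dom M i)" "inj_on (chart M i) (dom M i)"
    "dom M i \<subseteq> points M"
    "homeomorphic_map (subtopology (carrier_top M) (dom M i)) (top_of_set (chart M i ` dom M i)) (chart M i)"
proof -
  show o: "openin (carrier_top M) (dom M i)" and "open (chart M i ` dom M i)"
    and h: "homeomorphic_map (subtopology (carrier_top M) (dom M i)) (top_of_set (chart M i ` dom M i)) (chart M i)"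
    using assms by (auto simp: smooth_atlas_def)
  show sub: "dom M i \<subseteq> points M" using openin_subset[OF o] .
  from homeomorphic_imp_injective_map[OF h] sub show "inj_on (chart M i) (dom M i)"
    by (simp add: topspace_subtopology Int_absorb1)
qed

lemma chart_inv_chart:
  assumes "smooth_atlas M" "i \<in> index M" "p \<in> dom M i"
  shows "chart_inv M i (chart M i p) = p"
  using atlas_chart(3)[OF assms(1,2)] assms(3) by (simp add: chart_inv_def)

lemma chart_inv_in:
  assumes "x \<in> chart M i ` dom M i"
  shows "chart_inv M i x \<in> dom M i" "chart M i (chart_inv M i x) = x"
  using assms by (simp_all add: chart_inv_def inv_into_into f_inv_into_f)

lemma open_chart_image:
  assumes "smooth_atlas M" "i \<in> index M" "openin (carrier_top M) W"
  shows "open (chart M i ` (dom M i \<inter> W))"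
proof -
  note c = atlas_chart[OF assms(1,2)]
  have "openin (subtopology (carrier_top M) (dom M i)) (dom M i \<inter> W)"
    using assms(3) by (simp add: openin_subtopology_Int2)
  moreover have "dom M i \<inter> W \<subseteq> topspace (subtopology (carrier_top M) (dom M i))"
    using c(4) by auto
  ultimately have "openin (top_of_set (chart M i ` dom M i)) (chart M i ` (dom M i \<inter> W))"
    using homeomorphic_map_openness[OF c(5)] by blast
  then show ?thesis using c(2) openin_open_eq by blast
qed

lemma chart_image_Int_iff:
  assumes "smooth_atlas M" "i \<in> index M"
  shows "x \<in> chart M i ` (dom M i \<inter> W) \<longleftrightarrow> x \<in> chart M i ` dom M i \<and> chart_inv M i x \<in> W"
  using chart_inv_chart[OF assms] by force

section \<open>The metric in coordinates\<close>

text \<open>The first-order coefficients of the Laplacian, the metric trace of the Christoffel symbols.\<close>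

definition drift :: "('i, 'p, 'm::finite) rmfd \<Rightarrow> 'i \<Rightarrow> 'm \<Rightarrow> real^'m \<Rightarrow> real" where
  "drift M i c x = (\<Sum>a\<in>UNIV. \<Sum>b\<in>UNIV. inverse_metric_coeff M i a b x * christoffel M i c a b x)"

lemma coord_laplacian_eq:
  "coord_laplacian M i F = second_order_op (inverse_metric_coeff M i) (drift M i) F"
proof
  fix x
  have "(\<Sum>a\<in>UNIV. \<Sum>b\<in>UNIV. inverse_metric_coeff M i a b x * (\<Sum>c\<in>UNIV. christoffel M i c a b x * partial c F x))
     = (\<Sum>a\<in>UNIV. \<Sum>b\<in>UNIV. \<Sum>c\<in>UNIV. inverse_metric_coeff M i a b x * christoffel M i c a b x * partial c F x)"
    by (simp add: sum_distrib_left mult.assoc)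
  also have "\<dots> = (\<Sum>a\<in>UNIV. \<Sum>c\<in>UNIV. \<Sum>b\<in>UNIV. inverse_metric_coeff M i a b x * christoffel M i c a b x * partial c F x)"
    by (intro sum.cong refl sum.swap)
  also have "\<dots> = (\<Sum>c\<in>UNIV. \<Sum>a\<in>UNIV. \<Sum>b\<in>UNIV. inverse_metric_coeff M i a b x * christoffel M i c a b x * partial c F x)"
    by (rule sum.swap)
  also have "\<dots> = (\<Sum>c\<in>UNIV. drift M i c x * partial c F x)"
    by (simp add: drift_def sum_distrib_right)
  finally show "coord_laplacian M i F x = second_order_op (inverse_metric_coeff M i) (drift M i) F x"
    by (simp add: coord_laplacian_def second_order_op_def right_diff_distrib sum_subtractf)
qed

lemma matrix_inv_unique:
  fixes A :: "real^'n^'n"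
  assumes "A ** B = mat 1"
  shows "matrix_inv A = B"
proof -
  have "invertible A" using assms invertible_right_inverse by blast
  then have "matrix_inv A ** (A ** B) = B"
    by (simp add: matrix_mul_assoc matrix_inv_inverse)
  then show ?thesis using assms by simp
qed

lemma bilinear_coords:
  fixes g :: "real^'m::finite \<Rightarrow> real^'m \<Rightarrow> real"
  assumes "bilinear g"
  shows "g u v = (\<Sum>a\<in>UNIV. \<Sum>b\<in>UNIV. u $ a * v $ b * g (axis a 1) (axis b 1))"
proof -
  have e: "w = (\<Sum>a\<in>UNIV. (w $ a) *\<^sub>R axis a 1)" for w :: "real^'m"
    using basis_expansion[of w] by (simp add: scalar_mult_eq_scaleR)
  have "g u v = g (\<Sum>a\<in>UNIV. (u $ a) *\<^sub>R axis a 1) (\<Sum>b\<in>UNIV. (v $ b) *\<^sub>R axis b 1)"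
    using e by metis
  also have "\<dots> = (\<Sum>a\<in>UNIV. \<Sum>b\<in>UNIV. u $ a * v $ b * g (axis a 1) (axis b 1))"
    by (subst bilinear_sum[OF assms]) (simp_all add: sum.cartesian_product bilinear_lmul[OF assms] bilinear_rmul[OF assms] mult_ac)
  finally show ?thesis .
qed

text \<open>A vector in the kernel of the Gram matrix of a positive definite form has length zero, hence
  invertibility; the inverse is symmetric because its transpose is an inverse of the same matrix.\<close>

lemma metric_matrix:
  assumes "riemannian_metric M" "i \<in> index M" "x \<in> chart M i ` dom M i"
  shows "invertible (\<chi> c d. metric_coeff M i c d x)"
    and "metric_coeff M i a b x = metric_coeff M i b a x"
    and "inverse_metric_coeff M i a b x = inverse_metric_coeff M i b a x"
proof -
  let ?A = "\<chi> c d. metric_coeff M i c d x"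
  let ?g = "metric M i (chart_inv M i x)"
  have p: "chart_inv M i x \<in> dom M i" using chart_inv_in[OF assms(3)] by simp
  have bil: "bilinear ?g" and sym: "\<And>u v. ?g u v = ?g v u" and pos: "\<And>u. u \<noteq> 0 \<Longrightarrow> ?g u u > 0"
    using assms p unfolding riemannian_metric_def by blast+
  show s: "metric_coeff M i a b x = metric_coeff M i b a x" for a b
    using sym by (simp add: metric_coeff_def)
  have "u = 0" if "?A *v u = 0" for u
  proof (rule ccontr)
    assume "u \<noteq> 0"
    have "?g u u = (\<Sum>a\<in>UNIV. u $ a * (?A *v u) $ a)"
      by (simp add: bilinear_coords[OF bil, of u u] metric_coeff_def matrix_vector_mult_def sum_distrib_left mult_ac)
    also have "\<dots> = 0" using that by simp
    finally show False using pos[OF \<open>u \<noteq> 0\<close>] by simp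
  qed
  then show inv: "invertible ?A"
    using matrix_left_invertible_ker[of ?A] invertible_left_inverse by blast
  have tA: "transpose ?A = ?A" using s by (simp add: transpose_def vec_eq_iff)
  have "?A ** transpose (matrix_inv ?A) = transpose (matrix_inv ?A ** ?A)"
    by (simp add: matrix_transpose_mul tA)
  then have "?A ** transpose (matrix_inv ?A) = mat 1"
    by (simp add: matrix_inv_inverse[OF inv] transpose_mat)
  then have "matrix_inv ?A = transpose (matrix_inv ?A)" by (rule matrix_inv_unique)
  then have "matrix_inv ?A $ a $ b = transpose (matrix_inv ?A) $ a $ b" for a b by simp
  then show "inverse_metric_coeff M i a b x = inverse_metric_coeff M i b a x"
    unfolding inverse_metric_coeff_def by (metis (no_types) transpose_def vec_lambda_beta)
qed

lemma smooth_metric_coeffs: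
  assumes "smooth_atlas M" "riemannian_metric M" "i \<in> index M"
  shows "smooth_on (metric_coeff M i a b) (chart M i ` dom M i)"
    and "smooth_on (inverse_metric_coeff M i a b) (chart M i ` dom M i)"
    and "smooth_on (drift M i c) (chart M i ` dom M i)"
proof -
  note o = atlas_chart(2)[OF assms(1,3)]
  show m: "smooth_on (metric_coeff M i a b) (chart M i ` dom M i)" for a b
    using assms unfolding riemannian_metric_def metric_coeff_def[abs_def] by blast
  show inv: "smooth_on (inverse_metric_coeff M i a b) (chart M i ` dom M i)" for a b
    unfolding inverse_metric_coeff_def[abs_def]
    by (rule smooth_on_matrix_inv[OF o]) (simp_all add: m metric_matrix[OF assms(2,3)])
  show "smooth_on (drift M i c) (chart M i ` dom M i)"
    unfolding drift_def[abs_def] christoffel_def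
    by (intro smooth_on_sum smooth_on_mult smooth_on_diff smooth_on_add smooth_on_partial m inv smooth_on_const o)
qed

lemma smooth_on_coord_laplacian:
  assumes "smooth_atlas M" "riemannian_metric M" "i \<in> index M" "open S" "S \<subseteq> chart M i ` dom M i"
    and "smooth_on F S"
  shows "smooth_on (coord_laplacian M i F) S"
  unfolding coord_laplacian_eq
  by (intro smooth_on_second_order_op assms smooth_on_subset[OF smooth_metric_coeffs(2)[OF assms(1-3)]]
      smooth_on_subset[OF smooth_metric_coeffs(3)[OF assms(1-3)]])

section \<open>Products of Riemannian manifolds\<close>

lemma product_mfd_simps [simp]:
  "carrier_top (product_mfd M N) = prod_topology (carrier_top M) (carrier_top N)"
  "index (product_mfd M N) = index M \<times> index N"
  "dom (product_mfd M N) (i, j) = dom M i \<times> dom N j"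
  "chart (product_mfd M N) (i, j) (x, y) = join_vec (chart M i x) (chart N j y)"
  "metric (product_mfd M N) (i, j) (x, y) u v =
     metric M i x (left_vec u) (left_vec v) + metric N j y (right_vec u) (right_vec v)"
  by (simp_all add: product_mfd_def)

lemma product_chart_image:
  "w \<in> chart (product_mfd M N) (i, j) ` (D \<times> E) \<longleftrightarrow>
     left_vec w \<in> chart M i ` D \<and> right_vec w \<in> chart N j ` E"
proof
  assume "left_vec w \<in> chart M i ` D \<and> right_vec w \<in> chart N j ` E"
  then obtain x y where "x \<in> D" "y \<in> E" "left_vec w = chart M i x" "right_vec w = chart N j y" by auto
  then have "w = chart (product_mfd M N) (i, j) (x, y)" by (metis join_left_right product_mfd_simps(4))
  with \<open>x \<in> D\<close> \<open>y \<in> E\<close> show "w \<in> chart (product_mfd M N) (i, j) ` (D \<times> E)" by blast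
qed auto

lemma product_chart_inv:
  assumes "smooth_atlas M" "smooth_atlas N" "i \<in> index M" "j \<in> index N"
    and "left_vec w \<in> chart M i ` dom M i" "right_vec w \<in> chart N j ` dom N j"
  shows "chart_inv (product_mfd M N) (i, j) w = (chart_inv M i (left_vec w), chart_inv N j (right_vec w))"
  unfolding chart_inv_def[of "product_mfd M N"]
proof (rule inv_into_f_eq)
  show "inj_on (chart (product_mfd M N) (i, j)) (dom (product_mfd M N) (i, j))"
    using atlas_chart(3)[OF assms(1,3)] atlas_chart(3)[OF assms(2,4)]
    by (auto simp: inj_on_def join_vec_eq_iff)
qed (use chart_inv_in[OF assms(5)] chart_inv_in[OF assms(6)] in auto)

lemma open_left_right:
  assumes "open S" "open T"
  shows "open {w. left_vec w \<in> S \<and> right_vec w \<in> T}"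
proof -
  have "open (left_vec -` S \<inter> right_vec -` T)"
    by (intro open_Int open_vimage assms linear_continuous_on bounded_linear_left_vec bounded_linear_right_vec)
  then show ?thesis by (simp add: vimage_def Collect_conj_eq)
qed

lemma smooth_on_comp_left_right:
  fixes F :: "real^'m::finite \<Rightarrow> real" and G :: "real^'n::finite \<Rightarrow> real"
  shows "open O' \<Longrightarrow> smooth_on F S \<Longrightarrow> (\<And>w. w \<in> O' \<Longrightarrow> left_vec w \<in> S) \<Longrightarrow> smooth_on (\<lambda>w. F (left_vec w)) O'"
    "open O' \<Longrightarrow> smooth_on G T \<Longrightarrow> (\<And>w. w \<in> O' \<Longrightarrow> right_vec w \<in> T) \<Longrightarrow> smooth_on (\<lambda>w. G (right_vec w)) O'"
  by (auto intro: smooth_on_comp[where g = left_vec] smooth_on_comp[where g = right_vec] 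
      smooth_on_linear bounded_linear_left_vec bounded_linear_right_vec)

lemma homeomorphic_map_join:
  "homeomorphic_map (prod_topology (top_of_set S) (top_of_set T))
    (top_of_set {w. left_vec w \<in> S \<and> right_vec w \<in> T}) (\<lambda>(u, v). join_vec u v)"
proof -
  have "continuous_on A (\<lambda>z. join_vec (fst z) (snd z))" for A :: "((real^'a) \<times> (real^'b)) set"
    by (rule linear_continuous_on[OF bounded_linear_join])
  moreover have "continuous_on A (\<lambda>w. (left_vec w, right_vec w))" for A :: "(real^('a+'b)) set"
    by (intro continuous_intros linear_continuous_on bounded_linear_left_vec bounded_linear_right_vec)
  ultimately have "homeomorphic_maps (prod_topology (top_of_set S) (top_of_set T))
    (top_of_set {w. left_vec w \<in> S \<and> right_vec w \<in> T}) (\<lambda>(u, v). join_vec u v) (\<lambda>w. (left_vec w, right_vec w))"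
    by (auto simp: homeomorphic_maps_def subtopology_Times[symmetric] case_prod_unfold
        continuous_map_in_subtopology)
  then show ?thesis by (rule homeomorphic_maps_imp_map)
qed

lemma homeomorphic_map_prod:
  assumes "homeomorphic_map X X' f" "homeomorphic_map Y Y' g"
  shows "homeomorphic_map (prod_topology X Y) (prod_topology X' Y') (\<lambda>(x, y). (f x, g y))"
proof -
  obtain f' g' where "homeomorphic_maps X X' f f'" "homeomorphic_maps Y Y' g g'"
    using assms by (auto simp: homeomorphic_map_maps)
  then have "homeomorphic_maps (prod_topology X Y) (prod_topology X' Y') (\<lambda>(x,y). (f x, g y)) (\<lambda>(x,y). (f' x, g' y))"
    by (simp add: homeomorphic_maps_prod)
  then show ?thesis by (rule homeomorphic_maps_imp_map)
qed

text \<open>In the chart \<open>(i, j)\<close>, the chart image and the overlaps are the products of those of the factors,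
  under the identification by \<open>join_vec\<close>.\<close>

lemma smooth_atlas_product:
  assumes M: "smooth_atlas M" and N: "smooth_atlas N"
  shows "smooth_atlas (product_mfd M N)"
  unfolding smooth_atlas_def
proof (intro conjI ballI)
  let ?P = "product_mfd M N"
  have img: "chart ?P (i, j) ` dom ?P (i, j) =
      {w. left_vec w \<in> chart M i ` dom M i \<and> right_vec w \<in> chart N j ` dom N j}" for i j
    by (rule set_eqI) (simp add: product_chart_image)
  show "(\<Union>k\<in>index ?P. dom ?P k) = points ?P"
    by (auto simp: atlas_cover[OF M, symmetric] atlas_cover[OF N, symmetric])
  show "openin (carrier_top ?P) (dom ?P k)" "open (chart ?P k ` dom ?P k)"
    "homeomorphic_map (subtopology (carrier_top ?P) (dom ?P k)) (top_of_set (chart ?P k ` dom ?P k)) (chart ?P k)"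
    if kP: "k \<in> index ?P" for k
  proof -
    obtain i j where k: "k = (i, j)" "i \<in> index M" "j \<in> index N" using kP by auto
    note cM = atlas_chart[OF M k(2)] and cN = atlas_chart[OF N k(3)]
    show "openin (carrier_top ?P) (dom ?P k)" using cM cN by (simp add: k openin_prod_Times_iff)
    show "open (chart ?P k ` dom ?P k)" unfolding k img by (intro open_left_right cM cN)
    have "chart ?P (i, j) = (\<lambda>(u, v). join_vec u v) \<circ> (\<lambda>(x, y). (chart M i x, chart N j y))"
      by (auto simp: fun_eq_iff)
    then have "homeomorphic_map (prod_topology (subtopology (carrier_top M) (dom M i)) (subtopology (carrier_top N) (dom N j)))
        (top_of_set (chart ?P (i, j) ` dom ?P (i, j))) (chart ?P (i, j))"
      using homeomorphic_map_compose[OF homeomorphic_map_prod[OF cM(5) cN(5)] homeomorphic_map_join]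
      unfolding img by metis
    then show "homeomorphic_map (subtopology (carrier_top ?P) (dom ?P k)) (top_of_set (chart ?P k ` dom ?P k)) (chart ?P k)"
      unfolding k(1) product_mfd_simps(1,3) subtopology_Times .
  qed
  fix k l assume "k \<in> index ?P" "l \<in> index ?P"
  then obtain i j i' j' where k: "k = (i, j)" "i \<in> index M" "j \<in> index N"
    and l: "l = (i', j')" "i' \<in> index M" "j' \<in> index N" by auto
  let ?O = "chart ?P k ` (dom ?P k \<inter> dom ?P l)"
  have O: "w \<in> ?O \<longleftrightarrow> left_vec w \<in> chart M i ` (dom M i \<inter> dom M i') \<and> right_vec w \<in> chart N j ` (dom N j \<inter> dom N j')" for w
    by (simp add: k(1) l(1) Times_Int_Times product_chart_image)
  then have "?O = {w. left_vec w \<in> chart M i ` (dom M i \<inter> dom M i') \<and> right_vec w \<in> chart N j ` (dom N j \<inter> dom N j')}"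
    by blast
  then have oO: "open ?O"
    using open_left_right[OF open_chart_image[OF M k(2) atlas_chart(1)[OF M l(2)]] open_chart_image[OF N k(3) atlas_chart(1)[OF N l(3)]]]
    by simp
  show "smooth_on (chart ?P l \<circ> chart_inv ?P k) ?O"
  proof (rule smooth_on_cong[OF oO])
    have sm: "smooth_on (chart M i' \<circ> chart_inv M i) (chart M i ` (dom M i \<inter> dom M i'))"
      "smooth_on (chart N j' \<circ> chart_inv N j) (chart N j ` (dom N j \<inter> dom N j'))"
      using M N k l by (auto simp: smooth_atlas_def)
    show "smooth_on (\<lambda>w. join_vec ((chart M i' \<circ> chart_inv M i) (left_vec w)) ((chart N j' \<circ> chart_inv N j) (right_vec w))) ?O"
      using O by (intro smooth_on_join smooth_on_comp_vec[OF oO _ sm(1)] smooth_on_comp_vec[OF oO _ sm(2)] oO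
          open_chart_image M N k l atlas_chart smooth_on_linear bounded_linear_left_vec bounded_linear_right_vec) auto
    show "join_vec ((chart M i' \<circ> chart_inv M i) (left_vec w)) ((chart N j' \<circ> chart_inv N j) (right_vec w))
      = (chart ?P l \<circ> chart_inv ?P k) w" if "w \<in> ?O" for w
    proof -
      have "left_vec w \<in> chart M i ` dom M i" "right_vec w \<in> chart N j ` dom N j" using that O by auto
      then show ?thesis by (simp add: k(1) l(1) product_chart_inv[OF M N k(2,3)])
    qed
  qed
qed

lemma has_derivative_join:
  assumes "(F has_derivative F') (at x)" "(G has_derivative G') (at x)"
  shows "((\<lambda>x. join_vec (F x) (G x)) has_derivative (\<lambda>h. join_vec (F' h) (G' h))) (at x)"
  using bounded_linear.has_derivative[OF bounded_linear_join has_derivative_Pair[OF assms]] by simp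

text \<open>The derivative of a transition map of the product acts separately on the two blocks, so the invariance
  of the product metric reduces to that of the two summands.\<close>

lemma riemannian_metric_product:
  assumes M: "smooth_atlas M" "riemannian_metric M" and N: "smooth_atlas N" "riemannian_metric N"
  shows "riemannian_metric (product_mfd M N)"
  unfolding riemannian_metric_def
proof (intro conjI ballI allI)
  let ?P = "product_mfd M N"
  show "bilinear (metric ?P k p)" "metric ?P k p u v = metric ?P k p v u" "u \<noteq> 0 \<longrightarrow> metric ?P k p u u > 0"
    if kP: "k \<in> index ?P" "p \<in> dom ?P k" for k p u v
  proof -
    obtain i j x y where k: "k = (i, j)" "p = (x, y)" "i \<in> index M" "j \<in> index N" "x \<in> dom M i" "y \<in> dom N j"
      using kP by auto
    have bM: "bilinear (metric M i x)" and sM: "\<And>u v. metric M i x u v = metric M i x v u"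
      and pM: "\<And>u. u \<noteq> 0 \<Longrightarrow> metric M i x u u > 0"
      using M(2) k unfolding riemannian_metric_def by blast+
    have bN: "bilinear (metric N j y)" and sN: "\<And>u v. metric N j y u v = metric N j y v u"
      and pN: "\<And>u. u \<noteq> 0 \<Longrightarrow> metric N j y u u > 0"
      using N(2) k unfolding riemannian_metric_def by blast+
    have l: "linear (\<lambda>x. g (left_vec x) + h (right_vec x))" if "linear g" "linear h" for g h :: "_ \<Rightarrow> real"
      using linear_compose_add[OF linear_compose[OF linear_left_vec that(1)] linear_compose[OF linear_right_vec that(2)]]
      by (simp add: o_def)
    have lin: "linear (\<lambda>v. metric M i x (left_vec u) (left_vec v) + metric N j y (right_vec u) (right_vec v))"
      "linear (\<lambda>u. metric M i x (left_vec u) (left_vec v) + metric N j y (right_vec u) (right_vec v))" for u v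
      using l[of "metric M i x (left_vec u)" "metric N j y (right_vec u)"] bM bN
        l[of "\<lambda>u. metric M i x u (left_vec v)" "\<lambda>u. metric N j y u (right_vec v)"]
      by (simp_all add: bilinear_def)
    show "bilinear (metric ?P k p)" using lin by (simp add: k bilinear_def)
    show "metric ?P k p u v = metric ?P k p v u" using sM sN by (simp add: k)
    have nonneg: "metric M i x a a \<ge> 0" "metric N j y b b \<ge> 0" for a b
      using pM[of a] pN[of b] bilinear_lzero[OF bM] bilinear_lzero[OF bN] by (cases "a = 0"; cases "b = 0"; force)+
    show "u \<noteq> 0 \<longrightarrow> metric ?P k p u u > 0"
    proof
      assume "u \<noteq> 0"
      then have "left_vec u \<noteq> 0 \<or> right_vec u \<noteq> 0"
        by (metis join_left_right linear_0 linear_left_vec linear_right_vec)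
      then show "metric ?P k p u u > 0"
        using pM pN nonneg by (auto simp: k intro: add_pos_nonneg add_nonneg_pos)
    qed
  qed
next
  let ?P = "product_mfd M N"
  fix k u v assume "k \<in> index ?P"
  then obtain i j where k: "k = (i, j)" "i \<in> index M" "j \<in> index N" by auto
  let ?O = "chart ?P k ` dom ?P k"
  have oO: "open ?O" using atlas_chart(2)[OF smooth_atlas_product[OF M(1) N(1)], of k] k by simp
  have O: "left_vec w \<in> chart M i ` dom M i" "right_vec w \<in> chart N j ` dom N j" if "w \<in> ?O" for w
    using that by (simp_all add: k(1) product_chart_image)
  have sm: "smooth_on (\<lambda>x. metric M i (chart_inv M i x) a b) (chart M i ` dom M i)"
    "smooth_on (\<lambda>y. metric N j (chart_inv N j y) c d) (chart N j ` dom N j)" for a b c d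
    using M N k unfolding riemannian_metric_def by blast+
  show "smooth_on (\<lambda>w. metric ?P k (chart_inv ?P k w) u v) ?O"
  proof (rule smooth_on_cong[OF oO])
    show "smooth_on (\<lambda>w. metric M i (chart_inv M i (left_vec w)) (left_vec u) (left_vec v)
        + metric N j (chart_inv N j (right_vec w)) (right_vec u) (right_vec v)) ?O"
      using O by (intro smooth_on_add oO smooth_on_comp_left_right(1)[OF oO sm(1)] smooth_on_comp_left_right(2)[OF oO sm(2)])
  qed (simp add: k(1) product_chart_inv[OF M(1) N(1) k(2,3) O])
next
  let ?P = "product_mfd M N"
  fix k l p assume "k \<in> index ?P" "l \<in> index ?P" "p \<in> dom ?P k \<inter> dom ?P l"
  then obtain i j i' j' x y where k: "k = (i, j)" "i \<in> index M" "j \<in> index N"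
    and l: "l = (i', j')" "i' \<in> index M" "j' \<in> index N"
    and p: "p = (x, y)" "x \<in> dom M i \<inter> dom M i'" "y \<in> dom N j \<inter> dom N j'" by auto
  let ?S = "chart M i ` (dom M i \<inter> dom M i')" and ?T = "chart N j ` (dom N j \<inter> dom N j')"
  let ?F = "chart M i' \<circ> chart_inv M i" and ?G = "chart N j' \<circ> chart_inv N j"
  let ?F' = "frechet_derivative ?F (at (chart M i x))" and ?G' = "frechet_derivative ?G (at (chart N j y))"
  have oS: "open ?S" "open ?T"
    by (intro open_chart_image atlas_chart(1) M N k l)+
  have dF: "(?F has_derivative ?F') (at (chart M i x))"
    by (rule smooth_on_has_derivative[of _ ?S]) (use M k l p in \<open>auto simp: smooth_atlas_def\<close>)
  have dG: "(?G has_derivative ?G') (at (chart N j y))"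
    by (rule smooth_on_has_derivative[of _ ?T]) (use N k l p in \<open>auto simp: smooth_atlas_def\<close>)
  let ?w = "chart ?P k p" and ?O = "{w. left_vec w \<in> ?S \<and> right_vec w \<in> ?T}"
  have w: "left_vec ?w = chart M i x" "right_vec ?w = chart N j y" by (simp_all add: k p)
  have "((\<lambda>w. join_vec (?F (left_vec w)) (?G (right_vec w))) has_derivative
      (\<lambda>h. join_vec (?F' (left_vec h)) (?G' (right_vec h)))) (at ?w)"
  proof (rule has_derivative_join)
    show "((\<lambda>w. ?F (left_vec w)) has_derivative (\<lambda>h. ?F' (left_vec h))) (at ?w)"
      using has_derivative_compose[OF bounded_linear_imp_has_derivative[OF bounded_linear_left_vec], of ?F ?F' ?w UNIV] dF
      by (simp add: w)
    show "((\<lambda>w. ?G (right_vec w)) has_derivative (\<lambda>h. ?G' (right_vec h))) (at ?w)"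
      using has_derivative_compose[OF bounded_linear_imp_has_derivative[OF bounded_linear_right_vec], of ?G ?G' ?w UNIV] dG
      by (simp add: w)
  qed
  moreover have "join_vec (?F (left_vec w)) (?G (right_vec w)) = (chart ?P l \<circ> chart_inv ?P k) w" if "w \<in> ?O" for w
  proof -
    have "left_vec w \<in> chart M i ` dom M i" "right_vec w \<in> chart N j ` dom N j" using that by auto
    then show ?thesis by (simp add: k(1) l(1) product_chart_inv[OF M(1) N(1) k(2,3)])
  qed
  moreover have "?w \<in> ?O" using p(2,3) unfolding mem_Collect_eq w by blast
  ultimately have "((chart ?P l \<circ> chart_inv ?P k) has_derivative
      (\<lambda>h. join_vec (?F' (left_vec h)) (?G' (right_vec h)))) (at ?w)"
    using has_derivative_transform_within_open[OF _ open_left_right[OF oS]] by blast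
  then have T: "frechet_derivative (chart ?P l \<circ> chart_inv ?P k) (at ?w) = (\<lambda>h. join_vec (?F' (left_vec h)) (?G' (right_vec h)))"
    by (rule frechet_derivative_at[symmetric])
  have tM: "metric M i x a b = metric M i' x (?F' a) (?F' b)" for a b
    using M(2) k l p unfolding riemannian_metric_def Let_def by blast
  have tN: "metric N j y a b = metric N j' y (?G' a) (?G' b)" for a b
    using N(2) k l p unfolding riemannian_metric_def Let_def by blast
  show "let T = frechet_derivative (chart ?P l \<circ> chart_inv ?P k) (at (chart ?P k p))
      in \<forall>u v. metric ?P k p u v = metric ?P l p (T u) (T v)"
    unfolding T Let_def
    by (simp add: k(1) l(1) p(1)) (metis tM tN)
qed

section \<open>The Laplacian of a product\<close>

lemma sum_UNIV_Plus:
  fixes f :: "'a::finite + 'b::finite \<Rightarrow> real"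
  shows "(\<Sum>d\<in>UNIV. f d) = (\<Sum>a\<in>UNIV. f (Inl a)) + (\<Sum>c\<in>UNIV. f (Inr c))"
  by (simp add: UNIV_Plus_UNIV[symmetric] sum.Plus o_def del: UNIV_Plus_UNIV)

text \<open>The image of the chart \<open>(i, j)\<close> of the product, described by conditions on the two blocks so that no
  point of the manifold needs to be named.\<close>

abbreviation product_range where
  "product_range M N i j \<equiv>
    {w. left_vec w \<in> chart M i ` dom M i \<and> right_vec w \<in> chart N j ` dom N j}"

context
  fixes M :: "('i, 'p, 'm::finite) rmfd" and N :: "('j, 'q, 'n::finite) rmfd" and i j
  assumes M: "smooth_atlas M" "riemannian_metric M" "i \<in> index M"
    and N: "smooth_atlas N" "riemannian_metric N" "j \<in> index N"
begin

lemma open_product_range: "open (product_range M N i j)"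
  by (intro open_left_right atlas_chart(2) M N)

lemma product_metric_coeff:
  assumes "w \<in> product_range M N i j"
  shows "metric_coeff (product_mfd M N) (i, j) a b w = (case (a, b) of (Inl a, Inl b) \<Rightarrow> metric_coeff M i a b (left_vec w)
    | (Inr a, Inr b) \<Rightarrow> metric_coeff N j a b (right_vec w) | _ \<Rightarrow> 0)"
proof -
  have "bilinear (metric M i (chart_inv M i (left_vec w)))"
    using assms chart_inv_in(1)[of "left_vec w" M i] M by (auto simp: riemannian_metric_def)
  moreover have "bilinear (metric N j (chart_inv N j (right_vec w)))"
    using assms chart_inv_in(1)[of "right_vec w" N j] N by (auto simp: riemannian_metric_def)
  ultimately show ?thesis
    using assms
    by (simp add: metric_coeff_def product_chart_inv[OF M(1) N(1) M(3) N(3)] bilinear_lzero bilinear_rzero split: sum.split)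
qed

lemma product_inverse_metric_coeff:
  assumes "w \<in> product_range M N i j"
  shows "inverse_metric_coeff (product_mfd M N) (i, j) a b w = (case (a, b) of (Inl a, Inl b) \<Rightarrow> inverse_metric_coeff M i a b (left_vec w)
    | (Inr a, Inr b) \<Rightarrow> inverse_metric_coeff N j a b (right_vec w) | _ \<Rightarrow> 0)"
proof -
  let ?A = "\<chi> c d. metric_coeff M i c d (left_vec w)" and ?B = "\<chi> c d. metric_coeff N j c d (right_vec w)"
  let ?C = "\<chi> a b. (case (a, b) of (Inl a, Inl b) \<Rightarrow> matrix_inv ?A $ a $ b
    | (Inr a, Inr b) \<Rightarrow> matrix_inv ?B $ a $ b | _ \<Rightarrow> 0)"
  have "?A ** matrix_inv ?A = mat 1" "?B ** matrix_inv ?B = mat 1"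
    using assms M N by (auto intro!: matrix_inv_inverse metric_matrix(1))
  then have A: "(\<Sum>d\<in>UNIV. metric_coeff M i a d (left_vec w) * matrix_inv ?A $ d $ b) = (if a = b then 1 else 0)"
    and B: "(\<Sum>d\<in>UNIV. metric_coeff N j c d (right_vec w) * matrix_inv ?B $ d $ e) = (if c = e then 1 else 0)" for a b c e
    by (simp_all add: matrix_matrix_mult_def mat_def vec_eq_iff)
  have "(\<Sum>d\<in>UNIV. metric_coeff (product_mfd M N) (i, j) a d w * ?C $ d $ b) = (if a = b then 1 else 0)" for a b
    by (cases a; cases b) (simp_all add: sum_UNIV_Plus product_metric_coeff[OF assms] A B)
  then have "(\<chi> a b. metric_coeff (product_mfd M N) (i, j) a b w) ** ?C = mat 1"
    by (simp add: vec_eq_iff matrix_matrix_mult_def mat_def)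
  then show ?thesis
    unfolding inverse_metric_coeff_def by (simp add: matrix_inv_unique split: sum.split)
qed

lemma partial_product_metric_coeff:
  assumes "w \<in> product_range M N i j"
  shows "partial d (metric_coeff (product_mfd M N) (i, j) a b) w = (case (d, a, b) of
      (Inl d, Inl a, Inl b) \<Rightarrow> partial d (metric_coeff M i a b) (left_vec w)
    | (Inr d, Inr a, Inr b) \<Rightarrow> partial d (metric_coeff N j a b) (right_vec w) | _ \<Rightarrow> 0)"
proof -
  have dM: "metric_coeff M i a b differentiable (at (left_vec w))" for a b
    using assms smooth_on_differentiable[OF smooth_metric_coeffs(1)[OF M]] by blast
  have dN: "metric_coeff N j a b differentiable (at (right_vec w))" for a b
    using assms smooth_on_differentiable[OF smooth_metric_coeffs(1)[OF N]] by blast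
  have "partial d (metric_coeff (product_mfd M N) (i, j) a b) w = partial d (\<lambda>w. (case (a, b) of (Inl a, Inl b) \<Rightarrow> metric_coeff M i a b (left_vec w)
    | (Inr a, Inr b) \<Rightarrow> metric_coeff N j a b (right_vec w) | _ \<Rightarrow> 0)) w"
    by (rule partial_cong_open[OF open_product_range assms product_metric_coeff])
  then show ?thesis
    by (cases d; cases a; cases b) (simp_all add: partial_comp_left[OF dM] partial_comp_right[OF dN])
qed

text \<open>The metric is block diagonal and each block depends on its own variables only, so every Christoffel
  symbol with mixed indices vanishes.\<close>

lemma product_drift:
  assumes "w \<in> product_range M N i j"
  shows "drift (product_mfd M N) (i, j) c w = (case c of Inl c \<Rightarrow> drift M i c (left_vec w) | Inr c \<Rightarrow> drift N j c (right_vec w))"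
  by (cases c) (simp_all add: drift_def christoffel_def sum_UNIV_Plus product_inverse_metric_coeff[OF assms]
      partial_product_metric_coeff[OF assms])

lemma product_laplacian:
  assumes w: "w \<in> product_range M N i j" and S: "open S" "smooth_on F S" "w \<in> S"
  shows "coord_laplacian (product_mfd M N) (i, j) F w =
    coord_laplacian M i (\<lambda>x. F (join_vec x (right_vec w))) (left_vec w)
    + coord_laplacian N j (\<lambda>y. F (join_vec (left_vec w) y)) (right_vec w)"
proof -
  have jw: "join_vec (left_vec w) (right_vec w) \<in> S" using S by simp
  show ?thesis
    unfolding coord_laplacian_eq second_order_op_slice_left[OF S(1,2) jw] second_order_op_slice_right[OF S(1,2) jw]
    by (simp add: second_order_op_def sum_UNIV_Plus product_inverse_metric_coeff[OF w] product_drift[OF w])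
qed

end

section \<open>Euclidean space\<close>

lemma euclidean_mfd_simps [simp]:
  "carrier_top euclidean_mfd = euclidean" "index euclidean_mfd = UNIV" "dom euclidean_mfd k = UNIV"
  "chart euclidean_mfd k = (\<lambda>x. x)" "metric euclidean_mfd k p u v = u \<bullet> v"
  "chart_inv euclidean_mfd k = (\<lambda>x. x)"
proof -
  show "chart_inv euclidean_mfd k = (\<lambda>x. x)"
    by (rule ext) (simp add: chart_inv_def euclidean_mfd_def inv_into_f_eq inj_on_def)
qed (simp_all add: euclidean_mfd_def)

lemma euclidean_laplacian:
  fixes F :: "real^'k::finite \<Rightarrow> real"
  shows "coord_laplacian euclidean_mfd k F x = (\<Sum>a\<in>UNIV. partial a (partial a F) x)"
proof -
  have m: "metric_coeff euclidean_mfd k a b = (\<lambda>x. if a = b then 1 else 0)" for a b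
    by (rule ext) (simp add: metric_coeff_def inner_axis_axis)
  have "inverse_metric_coeff euclidean_mfd k a b x = (if a = b then 1 else 0)" for a b
    using matrix_inv_unique[OF matrix_mul_lid[of "mat 1 :: real^'k^'k"]]
    unfolding inverse_metric_coeff_def m by (simp add: mat_def)
  then show ?thesis
    unfolding coord_laplacian_def christoffel_def m
    by (simp add: if_distrib[of "\<lambda>t. t * _"] cong: if_cong)
qed

lemma harmonic_on_euclidean:
  "harmonic_on euclidean_mfd U f \<longleftrightarrow> smooth_on f U \<and> (\<forall>x\<in>U. (\<Sum>a\<in>UNIV. partial a (partial a f) x) = 0)"
  by (auto simp: harmonic_on_def smooth_fun_on_def has_laplacian_def euclidean_laplacian o_def)

lemma partial_translate:
  assumes "f differentiable (at (x + c))"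
  shows "partial a (\<lambda>x. f (x + c)) x = partial a f (x + c)"
proof -
  have "((\<lambda>x. x + c) has_derivative (\<lambda>h. h)) (at x)" by (auto intro!: derivative_eq_intros)
  from partial_eqI[OF diff_chain_at[OF this assms[unfolded frechet_derivative_works], unfolded o_def]]
  show ?thesis by (simp add: partial_def)
qed

lemma harmonic_on_translate:
  assumes "open U" "harmonic_on euclidean_mfd U f"
  shows "harmonic_on euclidean_mfd {x. x + c \<in> U} (\<lambda>x. f (x + c))"
proof -
  have s: "smooth_on f U" using assms(2) by (simp add: harmonic_on_euclidean)
  have "continuous_on UNIV (\<lambda>x. x + c)" by (intro continuous_intros)
  from open_vimage[OF assms(1) this] have o: "open {x. x + c \<in> U}" by (simp add: vimage_def)
  have "smooth_on (\<lambda>x. x + c) {x. x + c \<in> U}"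
    by (intro smooth_on_add o smooth_on_const smooth_on_linear bounded_linear_ident)
  then have "smooth_on (\<lambda>x. f (x + c)) {x. x + c \<in> U}"
    by (rule smooth_on_comp[OF o s]) auto
  moreover have "partial a (partial a (\<lambda>x. f (x + c))) x = partial a (partial a f) (x + c)" if "x + c \<in> U" for a x
  proof -
    have "partial a (partial a (\<lambda>x. f (x + c))) x = partial a (\<lambda>x. partial a f (x + c)) x"
      by (rule partial_cong_open[OF o]) (use that in \<open>auto intro: partial_translate smooth_on_differentiable[OF s]\<close>)
    also have "\<dots> = partial a (partial a f) (x + c)"
      by (rule partial_translate) (rule smooth_on_differentiable[OF smooth_on_partial[OF s] that])
    finally show ?thesis .
  qed
  ultimately show ?thesis using assms(2) by (simp add: harmonic_on_euclidean)
qed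

lemma partial_vec_nth: "partial a (\<lambda>x. x $ l) x = axis a 1 $ l"
  by (rule partial_eqI) (rule bounded_linear_imp_has_derivative[OF bounded_linear_vec_nth])

lemma harmonic_on_vec_nth: "harmonic_on euclidean_mfd UNIV (\<lambda>x. x $ l)"
proof -
  have "partial a (\<lambda>x::real^'a. x $ l) = (\<lambda>x. axis a 1 $ l)" for a
    by (rule ext) (rule partial_vec_nth)
  then show ?thesis by (simp add: harmonic_on_euclidean smooth_on_linear bounded_linear_vec_nth)
qed

text \<open>With \<open>z = u + i v\<close> these are the real part of \<open>z\<^sup>4\<close> and a quarter of its imaginary part.\<close>

lemma harmonic_quartics:
  fixes c :: "real^'k::finite"
  assumes "\<alpha> \<noteq> \<beta>"
  defines "u \<equiv> \<lambda>x. x $ \<alpha> - c $ \<alpha>" and "v \<equiv> \<lambda>x. x $ \<beta> - c $ \<beta>"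
  shows "harmonic_on euclidean_mfd UNIV (\<lambda>x. u x * u x * (u x * u x) - 6 * (u x * u x * (v x * v x)) + v x * v x * (v x * v x))"
    (is "harmonic_on _ _ ?f")
    and "harmonic_on euclidean_mfd UNIV (\<lambda>x. u x * u x * (u x * v x) - u x * v x * (v x * v x))"
    (is "harmonic_on _ _ ?g")
proof -
  have d: "(u has_derivative (\<lambda>h. h $ \<alpha>)) (at x)" "(v has_derivative (\<lambda>h. h $ \<beta>)) (at x)" for x
    unfolding u_def v_def
    by (auto intro!: derivative_eq_intros bounded_linear_imp_has_derivative bounded_linear_vec_nth)
  note ders = derivative_eq_intros d
  have su: "smooth_on u UNIV" "smooth_on v UNIV" unfolding u_def v_def
    by (intro smooth_on_diff smooth_on_const open_UNIV smooth_on_linear bounded_linear_vec_nth)+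
  let ?e = "\<lambda>a l. (axis a 1 :: real^'k) $ l"
  have sums: "(\<Sum>a\<in>UNIV. ?e a \<alpha> * ?e a \<alpha>) = 1" "(\<Sum>a\<in>UNIV. ?e a \<beta> * ?e a \<beta>) = 1" "(\<Sum>a\<in>UNIV. ?e a \<alpha> * ?e a \<beta>) = 0"
    using assms(1) by (simp_all add: axis_def if_distrib[of "\<lambda>t. t * _"] cong: if_cong)
  have f1: "partial a ?f = (\<lambda>x. (4 * u x ^ 3 - 12 * u x * v x ^ 2) * ?e a \<alpha> + (4 * v x ^ 3 - 12 * u x ^ 2 * v x) * ?e a \<beta>)" for a
    by (rule ext, rule partial_eqI[THEN trans], (rule ders refl)+) (simp add: power2_eq_square power3_eq_cube algebra_simps)
  have f2: "partial a (partial a ?f) x = (12 * u x ^ 2 - 12 * v x ^ 2) * (?e a \<alpha> * ?e a \<alpha>)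
     + (12 * v x ^ 2 - 12 * u x ^ 2) * (?e a \<beta> * ?e a \<beta>) - 48 * u x * v x * (?e a \<alpha> * ?e a \<beta>)" for a x
    unfolding f1
    by (rule partial_eqI[THEN trans], (rule ders refl)+) (simp add: power2_eq_square power3_eq_cube algebra_simps)
  have "(\<Sum>a\<in>UNIV. partial a (partial a ?f) x) = 0" for x
    unfolding f2 sum.distrib sum_subtractf sum_distrib_left[symmetric] sums by simp
  moreover have "smooth_on ?f UNIV"
    by (intro smooth_on_add smooth_on_diff smooth_on_mult smooth_on_const su open_UNIV)
  ultimately show "harmonic_on euclidean_mfd UNIV ?f" by (simp add: harmonic_on_euclidean)
  have g1: "partial a ?g = (\<lambda>x. (3 * u x ^ 2 * v x - v x ^ 3) * ?e a \<alpha> + (u x ^ 3 - 3 * u x * v x ^ 2) * ?e a \<beta>)" for a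
    by (rule ext, rule partial_eqI[THEN trans], (rule ders refl)+) (simp add: power2_eq_square power3_eq_cube algebra_simps)
  have g2: "partial a (partial a ?g) x = 6 * u x * v x * (?e a \<alpha> * ?e a \<alpha>)
     - 6 * u x * v x * (?e a \<beta> * ?e a \<beta>) + 6 * (u x ^ 2 - v x ^ 2) * (?e a \<alpha> * ?e a \<beta>)" for a x
    unfolding g1
    by (rule partial_eqI[THEN trans], (rule ders refl)+) (simp add: power2_eq_square power3_eq_cube algebra_simps)
  have "(\<Sum>a\<in>UNIV. partial a (partial a ?g) x) = 0" for x
    unfolding g2 sum.distrib sum_subtractf sum_distrib_left[symmetric] sums by simp
  moreover have "smooth_on ?g UNIV"
    by (intro smooth_on_add smooth_on_diff smooth_on_mult smooth_on_const su open_UNIV)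
  ultimately show "harmonic_on euclidean_mfd UNIV ?g" by (simp add: harmonic_on_euclidean)
qed

section \<open>Testing generalized harmonic morphisms with quartics\<close>

lemma smooth_map_euclidean:
  assumes "smooth_map M euclidean_mfd \<phi>" "i \<in> index M"
  shows "smooth_on (\<lambda>x. \<phi> (chart_inv M i x)) (chart M i ` dom M i)"
  using assms by (simp add: smooth_map_def o_def)

lemma generalized_harmonic_morphismD:
  "generalized_harmonic_morphism M euclidean_mfd \<phi> \<Longrightarrow> open U \<Longrightarrow> points M \<inter> \<phi> -` U \<noteq> {} \<Longrightarrow>
    harmonic_on euclidean_mfd U f \<Longrightarrow> biharmonic_on M (points M \<inter> \<phi> -` U) (f \<circ> \<phi>)"
  by (simp add: generalized_harmonic_morphism_def)

lemma harmonic_morphismD: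
  "harmonic_morphism M euclidean_mfd \<phi> \<Longrightarrow> open U \<Longrightarrow> points M \<inter> \<phi> -` U \<noteq> {} \<Longrightarrow>
    harmonic_on euclidean_mfd U f \<Longrightarrow> harmonic_on M (points M \<inter> \<phi> -` U) (f \<circ> \<phi>)"
  by (simp add: harmonic_morphism_def)

lemma harmonic_on_chart:
  "harmonic_on M W f \<Longrightarrow> i \<in> index M \<Longrightarrow> p \<in> dom M i \<inter> W \<Longrightarrow>
    coord_laplacian M i (f \<circ> chart_inv M i) (chart M i p) = 0"
  by (simp add: harmonic_on_def has_laplacian_def)

lemma biharmonic_on_chart:
  assumes M: "smooth_atlas M" "i \<in> index M" and W: "openin (carrier_top M) W" and f: "biharmonic_on M W f"
    and p: "p \<in> dom M i \<inter> W"
  shows "coord_laplacian M i (coord_laplacian M i (f \<circ> chart_inv M i)) (chart M i p) = 0"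
proof -
  obtain u where u: "has_laplacian M W f u" "has_laplacian M W u (\<lambda>_. 0)"
    using f by (auto simp: biharmonic_on_def)
  have "coord_laplacian M i (coord_laplacian M i (f \<circ> chart_inv M i)) (chart M i p) = coord_laplacian M i (u \<circ> chart_inv M i) (chart M i p)"
    unfolding coord_laplacian_eq[of M i "coord_laplacian M i (f \<circ> chart_inv M i)"] coord_laplacian_eq[of M i "u \<circ> chart_inv M i"]
  proof (rule second_order_op_cong_open[OF open_chart_image[OF M W]])
    fix x assume "x \<in> chart M i ` (dom M i \<inter> W)"
    then obtain q where "q \<in> dom M i \<inter> W" "x = chart M i q" by auto
    then show "coord_laplacian M i (f \<circ> chart_inv M i) x = (u \<circ> chart_inv M i) x"
      using u(1) M by (simp add: has_laplacian_def chart_inv_chart)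
  qed (use p in auto)
  then show ?thesis using u(2) M p by (simp add: has_laplacian_def)
qed

text \<open>With \<open>a\<close>, \<open>b\<close>, \<open>c\<close> the inner products of the gradients of \<open>u\<close> and \<open>v\<close> at \<open>p\<close>, the pullbacks of the two
  quartics have bi-Laplacian \<open>24 ((a - b)\<^sup>2 - 4 c\<^sup>2)\<close> and \<open>24 (a - b) c\<close> there. Both vanish only if
  \<open>a = b\<close> and \<open>c = 0\<close>.\<close>

lemma generalized_harmonic_morphism_gram:
  fixes \<phi> :: "'p \<Rightarrow> real^'k::finite"
  assumes M: "smooth_atlas M" "riemannian_metric M" and gen: "generalized_harmonic_morphism M euclidean_mfd \<phi>"
    and i: "i \<in> index M" and p: "p \<in> dom M i" and "\<alpha> \<noteq> \<beta>"
  defines "F \<equiv> \<lambda>l x. \<phi> (chart_inv M i x) $ l"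
  shows "grad_prod (inverse_metric_coeff M i) (F \<alpha>) (F \<alpha>) (chart M i p) = grad_prod (inverse_metric_coeff M i) (F \<beta>) (F \<beta>) (chart M i p)"
    and "grad_prod (inverse_metric_coeff M i) (F \<alpha>) (F \<beta>) (chart M i p) = 0"
proof -
  let ?U = "chart M i ` dom M i" and ?x = "chart M i p"
  let ?A = "inverse_metric_coeff M i" and ?B = "drift M i"
  let ?L = "second_order_op ?A ?B"
  let ?c = "\<phi> p"
  define u where "u = (\<lambda>x. F \<alpha> x - ?c $ \<alpha>)"
  define v where "v = (\<lambda>x. F \<beta> x - ?c $ \<beta>)"
  have U: "open ?U" "?x \<in> ?U" using atlas_chart(2)[OF M(1) i] p by auto
  have sm: "smooth_map M euclidean_mfd \<phi>" using gen by (simp add: generalized_harmonic_morphism_def)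
  have sF: "smooth_on (F l) ?U" for l
    using smooth_map_euclidean[OF sm i] U(1) by (simp add: F_def smooth_on_vec_iff)
  have s: "smooth_on u ?U" "smooth_on v ?U"
    unfolding u_def v_def by (intro smooth_on_diff smooth_on_const sF U)+
  have zero: "u ?x = 0" "v ?x = 0" by (simp_all add: u_def v_def F_def chart_inv_chart[OF M(1) i p])
  note sc = smooth_metric_coeffs[OF M i]
  define a b c where "a = grad_prod ?A u u ?x" and "b = grad_prod ?A v v ?x" and "c = grad_prod ?A u v ?x"
  have sym: "?A a b y = ?A b a y" if "y \<in> ?U" for a b y using metric_matrix(3)[OF M(2) i that] .
  have vu: "grad_prod ?A v u ?x = c" unfolding c_def by (rule grad_prod_commute) (rule sym[OF U(2)])
  have bih: "?L (?L (\<lambda>x. h (\<phi> (chart_inv M i x)))) ?x = 0" if h: "harmonic_on euclidean_mfd UNIV h" for h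
  proof -
    have "points M \<noteq> {}" using p atlas_chart(4)[OF M(1) i] by auto
    then have "biharmonic_on M (points M) (h \<circ> \<phi>)"
      using generalized_harmonic_morphismD[OF gen open_UNIV _ h] by simp
    from biharmonic_on_chart[OF M(1) i openin_topspace this, of p] p atlas_chart(4)[OF M(1) i]
    show ?thesis by (auto simp: coord_laplacian_eq o_def)
  qed
  let ?uuuu = "\<lambda>x. u x * u x * (u x * u x)" and ?uuvv = "\<lambda>x. u x * u x * (v x * v x)" and ?vvvv = "\<lambda>x. v x * v x * (v x * v x)"
  let ?uuuv = "\<lambda>x. u x * u x * (u x * v x)" and ?uvvv = "\<lambda>x. u x * v x * (v x * v x)"
  have q: "smooth_on ?uuuu ?U" "smooth_on ?uuvv ?U" "smooth_on ?vvvv ?U" "smooth_on ?uuuv ?U" "smooth_on ?uvvv ?U"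
    by (intro smooth_on_mult U s)+
  have sL: "smooth_on (?L H) ?U" if "smooth_on H ?U" for H
    by (intro smooth_on_second_order_op sc U that)
  have "?L (?L (\<lambda>x. ?uuuu x - 6 * ?uuvv x + ?vvvv x)) ?x = ?L (\<lambda>x. ?L ?uuuu x - 6 * ?L ?uuvv x + ?L ?vvvv x) ?x"
    by (rule second_order_op_cong_open[OF U])
      (simp add: second_order_op_add[OF U(1)] second_order_op_diff[OF U(1)] second_order_op_cmult[OF U(1)] q
        smooth_on_diff[OF U(1)] smooth_on_mult[OF U(1)] smooth_on_const s)
  also have "\<dots> = ?L (?L ?uuuu) ?x - 6 * ?L (?L ?uuvv) ?x + ?L (?L ?vvvv) ?x"
    using U(2) by (simp add: second_order_op_add[OF U(1)] second_order_op_diff[OF U(1)] second_order_op_cmult[OF U(1)] q sL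
        smooth_on_diff[OF U(1)] smooth_on_mult[OF U(1)] smooth_on_const)
  finally have "?L (?L ?uuuu) ?x - 6 * ?L (?L ?uuvv) ?x + ?L (?L ?vvvv) ?x = 0"
    using bih[OF harmonic_quartics(1)[OF \<open>\<alpha> \<noteq> \<beta>\<close>, of ?c]] by (simp add: u_def v_def F_def)
  then have 1: "(a - b)\<^sup>2 = 4 * c\<^sup>2"
    using second_order_op_square_quartic[OF U sc(2) sym sc(3) s(1) s(1) s(1) s(1) zero(1) zero(1) zero(1) zero(1)]
      second_order_op_square_quartic[OF U sc(2) sym sc(3) s(1) s(1) s(2) s(2) zero(1) zero(1) zero(2) zero(2)]
      second_order_op_square_quartic[OF U sc(2) sym sc(3) s(2) s(2) s(2) s(2) zero(2) zero(2) zero(2) zero(2)]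
    by (simp add: a_def[symmetric] b_def[symmetric] c_def[symmetric] vu power2_eq_square algebra_simps)
  have "?L (?L (\<lambda>x. ?uuuv x - ?uvvv x)) ?x = ?L (\<lambda>x. ?L ?uuuv x - ?L ?uvvv x) ?x"
    by (rule second_order_op_cong_open[OF U]) (simp add: second_order_op_diff[OF U(1)] q)
  also have "\<dots> = ?L (?L ?uuuv) ?x - ?L (?L ?uvvv) ?x"
    using U(2) by (simp add: second_order_op_diff[OF U(1)] q sL)
  finally have "?L (?L ?uuuv) ?x - ?L (?L ?uvvv) ?x = 0"
    using bih[OF harmonic_quartics(2)[OF \<open>\<alpha> \<noteq> \<beta>\<close>, of ?c]] by (simp add: u_def v_def F_def)
  then have 2: "a * c = b * c"
    using second_order_op_square_quartic[OF U sc(2) sym sc(3) s(1) s(1) s(1) s(2) zero(1) zero(1) zero(1) zero(2)]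
      second_order_op_square_quartic[OF U sc(2) sym sc(3) s(1) s(2) s(2) s(2) zero(1) zero(2) zero(2) zero(2)]
    by (simp add: a_def[symmetric] b_def[symmetric] c_def[symmetric] vu power2_eq_square algebra_simps)
  have "c = 0" using 1 2 by (cases "c = 0") auto
  then have "a = b" using 1 by simp
  have sh: "partial e u ?x = partial e (F \<alpha>) ?x" "partial e v ?x = partial e (F \<beta>) ?x" for e
    unfolding u_def v_def using smooth_on_differentiable[OF sF U(2)] by (simp_all add: partial_diff)
  show "grad_prod ?A (F \<alpha>) (F \<alpha>) ?x = grad_prod ?A (F \<beta>) (F \<beta>) ?x" "grad_prod ?A (F \<alpha>) (F \<beta>) ?x = 0"
    using \<open>a = b\<close> \<open>c = 0\<close> by (simp_all add: a_def b_def c_def grad_prod_def sh)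
qed

section \<open>Horizontal conformality\<close>

text \<open>The condition for horizontal weak conformality at one point, with the square of the dilation as
  parameter, stated for bare linear data so that it can be moved from one chart to another.\<close>

definition conformal_on_horizontal ::
  "(real^'m::finite \<Rightarrow> real^'m \<Rightarrow> real) \<Rightarrow> (real^'m \<Rightarrow> real^'k::finite) \<Rightarrow> real \<Rightarrow> bool" where
  "conformal_on_horizontal g d c \<longleftrightarrow> (\<forall>X. d X = 0) \<or> surj d \<and>
     (\<forall>X Y. (\<forall>V. d V = 0 \<longrightarrow> g X V = 0) \<longrightarrow> (\<forall>V. d V = 0 \<longrightarrow> g Y V = 0) \<longrightarrow> d X \<bullet> d Y = c * g X Y)"

lemma conformal_on_horizontal_pullback:
  assumes T: "bij T" and g: "\<And>u v. g u v = h (T u) (T v)" and d: "\<And>u. d u = e (T u)"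
    and c: "conformal_on_horizontal g d c"
  shows "conformal_on_horizontal h e c"
proof (cases "\<forall>X. d X = 0")
  case True
  then have "e X = 0" for X using d bij_is_surj[OF T] by (metis surjD)
  then show ?thesis by (simp add: conformal_on_horizontal_def)
next
  case False
  then have "surj d" and cc: "\<And>X Y. (\<forall>V. d V = 0 \<longrightarrow> g X V = 0) \<Longrightarrow> (\<forall>V. d V = 0 \<longrightarrow> g Y V = 0) \<Longrightarrow> d X \<bullet> d Y = c * g X Y"
    using c unfolding conformal_on_horizontal_def by blast+
  have "surj e" using \<open>surj d\<close> d unfolding surj_def by metis
  moreover have "e X \<bullet> e Y = c * h X Y"
    if X: "\<forall>V. e V = 0 \<longrightarrow> h X V = 0" and Y: "\<forall>V. e V = 0 \<longrightarrow> h Y V = 0" for X Y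
  proof -
    obtain X' Y' where "X = T X'" "Y = T Y'" using bij_is_surj[OF T] by (metis surjD)
    then show ?thesis using cc[of X' Y'] X Y by (simp add: g d)
  qed
  ultimately show ?thesis unfolding conformal_on_horizontal_def by blast
qed

text \<open>The gradients of the components of \<open>d\<close> span the orthogonal complement of the kernel. If their Gram
  matrix is \<open>c\<close> times the identity, then \<open>d\<close> maps them to \<open>c\<close> times the standard basis, so for
  \<open>c \<noteq> 0\<close> a horizontal vector is recovered from its image.\<close>

lemma conformal_of_scalar_gram:
  fixes g :: "real^'m::finite \<Rightarrow> real^'m \<Rightarrow> real" and d :: "real^'m \<Rightarrow> real^'k::finite"
  assumes g: "bilinear g" "\<And>u v. g u v = g v u" "\<And>u. u \<noteq> 0 \<Longrightarrow> g u u > 0" and d: "linear d"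
    and inv: "(\<chi> a b. g (axis a 1) (axis b 1)) ** B = mat 1"
    and gram: "\<And>\<alpha> \<beta>. (\<Sum>a\<in>UNIV. \<Sum>b\<in>UNIV. B $ a $ b * (d (axis a 1) $ \<alpha> * d (axis b 1) $ \<beta>)) = (if \<alpha> = \<beta> then c else 0)"
  shows "c \<ge> 0 \<and> conformal_on_horizontal g d c"
proof -
  \<comment> \<open>\<open>w \<alpha>\<close> is the covector of the component \<open>\<alpha>\<close> of \<open>d\<close>, and \<open>gr \<alpha>\<close> its gradient.\<close>
  define w where "w \<alpha> = (\<chi> b. d (axis b 1) $ \<alpha>)" for \<alpha>
  define gr where "gr \<alpha> = B *v w \<alpha>" for \<alpha>
  have dw: "d V $ \<alpha> = V \<bullet> w \<alpha>" for V \<alpha>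
  proof -
    have "d V = d (\<Sum>a\<in>UNIV. (V $ a) *\<^sub>R axis a 1)"
      using basis_expansion[of V] by (simp add: scalar_mult_eq_scaleR)
    also have "\<dots> = (\<Sum>a\<in>UNIV. V $ a *\<^sub>R d (axis a 1))" using d by (simp add: linear_sum linear_scale)
    finally show ?thesis by (simp add: inner_vec_def w_def)
  qed
  have ggr: "g V (gr \<alpha>) = d V $ \<alpha>" for V \<alpha>
  proof -
    have "g V (gr \<alpha>) = V \<bullet> ((\<chi> a b. g (axis a 1) (axis b 1)) *v gr \<alpha>)"
      by (simp add: bilinear_coords[OF g(1), of V] inner_vec_def matrix_vector_mult_def sum_distrib_left mult_ac)
    also have "(\<chi> a b. g (axis a 1) (axis b 1)) *v gr \<alpha> = w \<alpha>"
      by (simp add: gr_def matrix_vector_mul_assoc inv)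
    finally show ?thesis by (simp add: dw)
  qed
  have dgr: "d (gr \<beta>) $ \<alpha> = (if \<alpha> = \<beta> then c else 0)" for \<alpha> \<beta>
  proof -
    have "d (gr \<beta>) $ \<alpha> = gr \<beta> \<bullet> w \<alpha>" by (rule dw)
    also have "\<dots> = (\<Sum>a\<in>UNIV. \<Sum>b\<in>UNIV. B $ a $ b * (d (axis a 1) $ \<alpha> * d (axis b 1) $ \<beta>))"
      by (simp add: gr_def w_def inner_vec_def matrix_vector_mult_def sum_distrib_left mult_ac)
    finally have "d (gr \<beta>) $ \<alpha> = (\<Sum>a\<in>UNIV. \<Sum>b\<in>UNIV. B $ a $ b * (d (axis a 1) $ \<alpha> * d (axis b 1) $ \<beta>))" .
    then show ?thesis using gram by simp
  qed
  have gg: "g (gr \<alpha>) (gr \<alpha>) = c" for \<alpha> by (simp add: ggr dgr)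
  have g0: "g u u \<ge> 0" for u using g(3)[of u] bilinear_lzero[OF g(1)] by (cases "u = 0") auto
  have c: "c \<ge> 0" using gg[of undefined] g0 by metis
  moreover have "conformal_on_horizontal g d c"
  proof (cases "c = 0")
    case True
    then have "gr \<alpha> = 0" for \<alpha> using gg[of \<alpha>] g(3)[of "gr \<alpha>"] by force
    then have "d V $ \<alpha> = 0" for V \<alpha> using ggr[of V \<alpha>] bilinear_rzero[OF g(1)] by simp
    then show ?thesis by (simp add: conformal_on_horizontal_def vec_eq_iff)
  next
    case False
    \<comment> \<open>The horizontal right inverse of \<open>d\<close>.\<close>
    define lift where "lift \<xi> = (\<Sum>\<alpha>\<in>UNIV. (\<xi> $ \<alpha> / c) *\<^sub>R gr \<alpha>)" for \<xi> :: "real^'k"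
    have dlift: "d (lift \<xi>) = \<xi>" for \<xi>
      using False d by (simp add: lift_def linear_sum linear_scale vec_eq_iff dgr if_distrib[of "\<lambda>t. _ * t"] cong: if_cong)
    have glift: "g V (lift \<xi>) = d V \<bullet> \<xi> / c" for V \<xi>
      using g(1) by (simp add: lift_def bilinear_def linear_sum linear_scale ggr inner_vec_def sum_divide_distrib mult_ac)
    \<comment> \<open>\<open>X - lift (d X)\<close> is both in the kernel of \<open>d\<close> and orthogonal to it.\<close>
    have "d X \<bullet> d Y = c * g X Y" if X: "\<forall>V. d V = 0 \<longrightarrow> g X V = 0" for X Y
    proof -
      let ?V = "X - lift (d X)"
      have V: "d ?V = 0" using d by (simp add: linear_diff dlift)
      have "g ?V ?V = g X ?V - g (lift (d X)) ?V" by (rule bilinear_lsub[OF g(1)])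
      also have "\<dots> = 0" using X V by (simp add: g(2)[of "lift (d X)"] glift)
      finally have "X = lift (d X)" using g(3)[of ?V] by force
      then have "g Y X = d Y \<bullet> d X / c" using glift by metis
      then show ?thesis using False g(2)[of Y X] by (simp add: inner_commute)
    qed
    moreover have "surj d" using dlift by (rule surjI)
    ultimately show ?thesis unfolding conformal_on_horizontal_def by blast
  qed
  ultimately show ?thesis ..
qed


lemma differential_euclidean:
  "differential M euclidean_mfd \<phi> i k p = frechet_derivative (\<lambda>x. \<phi> (chart_inv M i x)) (at (chart M i p))"
  by (simp add: differential_def o_def)

lemma generalized_harmonic_morphism_conformal_chart:
  fixes M :: "('i, 'p, 'm::finite) rmfd" and \<phi> :: "'p \<Rightarrow> real^'k::finite"
  assumes M: "smooth_atlas M" "riemannian_metric M" and gen: "generalized_harmonic_morphism M euclidean_mfd \<phi>"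
    and i: "i \<in> index M" and p: "p \<in> dom M i"
  shows "\<exists>c\<ge>0. conformal_on_horizontal (metric M i p) (differential M euclidean_mfd \<phi> i () p) c"
proof -
  let ?x = "chart M i p"
  let ?f = "\<lambda>x. \<phi> (chart_inv M i x)" and ?A = "inverse_metric_coeff M i"
  let ?d = "frechet_derivative ?f (at ?x)"
  \<comment> \<open>All diagonal entries of the Gram matrix agree, so any index may supply the factor \<open>c\<close>.\<close>
  define \<alpha>0 :: 'k where "\<alpha>0 = undefined"
  have U: "open (chart M i ` dom M i)" "?x \<in> chart M i ` dom M i" using atlas_chart(2)[OF M(1) i] p by auto
  have "smooth_map M euclidean_mfd \<phi>" using gen by (simp add: generalized_harmonic_morphism_def)
  from smooth_on_has_derivative[OF smooth_map_euclidean[OF this i] U(2)]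
  have d: "(?f has_derivative ?d) (at ?x)" .
  have pd: "partial a (\<lambda>x. ?f x $ l) ?x = ?d (axis a 1) $ l" for a l
    by (rule partial_eqI) (rule bounded_linear.has_derivative[OF bounded_linear_vec_nth d])
  define c where "c = grad_prod ?A (\<lambda>x. ?f x $ \<alpha>0) (\<lambda>x. ?f x $ \<alpha>0) ?x"
  have gram: "grad_prod ?A (\<lambda>x. ?f x $ \<alpha>) (\<lambda>x. ?f x $ \<beta>) ?x = (if \<alpha> = \<beta> then c else 0)" for \<alpha> \<beta>
    using generalized_harmonic_morphism_gram[OF M gen i p] unfolding c_def by metis
  have p': "chart_inv M i ?x = p" by (rule chart_inv_chart[OF M(1) i p])
  have "c \<ge> 0 \<and> conformal_on_horizontal (metric M i p) ?d c"
  proof (rule conformal_of_scalar_gram)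
    show "bilinear (metric M i p)" "metric M i p u v = metric M i p v u" "u \<noteq> 0 \<Longrightarrow> metric M i p u u > 0" for u v
      using M(2) i p unfolding riemannian_metric_def by blast+
    show "linear ?d" by (rule has_derivative_linear[OF d])
    show "(\<chi> a b. metric M i p (axis a 1) (axis b 1)) ** matrix_inv (\<chi> a b. metric_coeff M i a b ?x) = mat 1"
      using matrix_inv_inverse(1)[OF metric_matrix(1)[OF M(2) i U(2)]] by (simp add: metric_coeff_def p')
    show "(\<Sum>a\<in>UNIV. \<Sum>b\<in>UNIV. matrix_inv (\<chi> a b. metric_coeff M i a b ?x) $ a $ b * (?d (axis a 1) $ \<alpha> * ?d (axis b 1) $ \<beta>))
        = (if \<alpha> = \<beta> then c else 0)" for \<alpha> \<beta>
      using gram[of \<alpha> \<beta>] by (simp add: grad_prod_def pd inverse_metric_coeff_def)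
  qed
  then show ?thesis unfolding differential_euclidean by blast
qed

text \<open>The derivative of the transition map is an isometry from the metric in one chart to the metric in the
  other and intertwines the two representatives of the differential. This lets the dilation be chosen
  once for each point instead of once for each chart.\<close>

lemma conformal_chart_change:
  fixes M :: "('i, 'p, 'm::finite) rmfd" and \<phi> :: "'p \<Rightarrow> real^'k::finite"
  assumes M: "smooth_atlas M" "riemannian_metric M" and sm: "smooth_map M euclidean_mfd \<phi>"
    and i: "i \<in> index M" "p \<in> dom M i" and j: "j \<in> index M" "p \<in> dom M j"
    and c: "conformal_on_horizontal (metric M i p) (differential M euclidean_mfd \<phi> i () p) c"
  shows "conformal_on_horizontal (metric M j p) (differential M euclidean_mfd \<phi> j () p) c"
proof -
  let ?t = "chart M j \<circ> chart_inv M i"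
  let ?T = "frechet_derivative ?t (at (chart M i p))"
  let ?S = "chart M i ` (dom M i \<inter> dom M j)"
  have S: "open ?S" "chart M i p \<in> ?S"
    using open_chart_image[OF M(1) i(1) atlas_chart(1)[OF M(1) j(1)]] i j by auto
  have "smooth_on ?t ?S" using M i j by (simp add: smooth_atlas_def)
  from smooth_on_has_derivative[OF this S(2)] have T: "(?t has_derivative ?T) (at (chart M i p))" .
  then have lin: "linear ?T" by (rule has_derivative_linear)
  have g: "metric M i p u v = metric M j p (?T u) (?T v)" for u v
    using M(2) i j unfolding riemannian_metric_def Let_def by blast
  have gi: "bilinear (metric M i p)" "\<And>u. u \<noteq> 0 \<Longrightarrow> metric M i p u u > 0" and gj: "bilinear (metric M j p)"
    using M(2) i j unfolding riemannian_metric_def by blast+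
  have "u = 0" if "?T u = 0" for u
    using g[of u u] gi(2)[of u] bilinear_lzero[OF gj] that by force
  then have "inj ?T" using lin linear_injective_0 by blast
  then have "bij ?T" using lin linear_injective_imp_surjective bij_def by blast
  have d: "differential M euclidean_mfd \<phi> i () p u = differential M euclidean_mfd \<phi> j () p (?T u)" for u
  proof -
    have tp: "?t (chart M i p) = chart M j p" using chart_inv_chart[OF M(1) i] by simp
    have "((\<lambda>x. \<phi> (chart_inv M j x)) has_derivative differential M euclidean_mfd \<phi> j () p) (at (?t (chart M i p)))"
      unfolding tp differential_euclidean
      by (rule smooth_on_has_derivative[OF smooth_map_euclidean[OF sm j(1)]]) (use j in auto)
    from diff_chain_at[OF T this]
    have "((\<lambda>x. \<phi> (chart_inv M i x)) has_derivative (differential M euclidean_mfd \<phi> j () p \<circ> ?T)) (at (chart M i p))"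
    proof (rule has_derivative_transform_within_open[OF _ S])
      fix x assume "x \<in> ?S"
      then obtain q where "q \<in> dom M i" "q \<in> dom M j" "x = chart M i q" by auto
      then show "((\<lambda>x. \<phi> (chart_inv M j x)) \<circ> ?t) x = \<phi> (chart_inv M i x)"
        by (simp add: chart_inv_chart[OF M(1)] i j)
    qed
    from frechet_derivative_at[OF this] show ?thesis
      unfolding differential_euclidean[of M \<phi> i] by (metis o_apply)
  qed
  show ?thesis
    by (rule conformal_on_horizontal_pullback[OF \<open>bij ?T\<close> _ _ c]) (fact g, fact d)
qed

theorem generalized_harmonic_morphism_horizontally_weakly_conformal:
  fixes M :: "('i, 'p, 'm::finite) rmfd" and \<phi> :: "'p \<Rightarrow> real^'k::finite"
  assumes M: "smooth_atlas M" "riemannian_metric M" and gen: "generalized_harmonic_morphism M euclidean_mfd \<phi>"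
  shows "horizontally_weakly_conformal M euclidean_mfd \<phi>"
proof -
  let ?conf = "\<lambda>i p c. conformal_on_horizontal (metric M i p) (differential M euclidean_mfd \<phi> i () p) c"
  have sm: "smooth_map M euclidean_mfd \<phi>" using gen by (simp add: generalized_harmonic_morphism_def)
  have "\<forall>p\<in>points M. \<exists>c\<ge>0. \<forall>i\<in>index M. p \<in> dom M i \<longrightarrow> ?conf i p c"
  proof
    fix p assume "p \<in> points M"
    then obtain i where i: "i \<in> index M" "p \<in> dom M i" using atlas_cover[OF M(1)] by blast
    obtain c where "c \<ge> 0" "?conf i p c" using generalized_harmonic_morphism_conformal_chart[OF M gen i] by blast
    then show "\<exists>c\<ge>0. \<forall>i\<in>index M. p \<in> dom M i \<longrightarrow> ?conf i p c"
      using conformal_chart_change[OF M sm i] by blast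
  qed
  then obtain c where c: "\<And>p. p \<in> points M \<Longrightarrow> c p \<ge> 0"
    "\<And>p i. p \<in> points M \<Longrightarrow> i \<in> index M \<Longrightarrow> p \<in> dom M i \<Longrightarrow> ?conf i p (c p)"
    by metis
  show ?thesis
    unfolding horizontally_weakly_conformal_def Let_def
  proof (intro conjI sm exI[of _ "\<lambda>p. sqrt (c p)"] ballI)
    show "sqrt (c p) \<ge> 0" if "p \<in> points M" for p using c(1) that by simp
    fix i k p assume "i \<in> index M" and k: "k \<in> index (euclidean_mfd :: (unit, real^'k, 'k) rmfd)"
      and "p \<in> dom M i \<inter> \<phi> -` dom euclidean_mfd k"
    then have p: "p \<in> points M" "i \<in> index M" "p \<in> dom M i" using atlas_cover[OF M(1)] by auto
    then show "(\<forall>X. differential M euclidean_mfd \<phi> i k p X = 0) \<or>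
       surj (differential M euclidean_mfd \<phi> i k p) \<and>
       (\<forall>X\<in>horizontal_space M euclidean_mfd \<phi> i k p. \<forall>Y\<in>horizontal_space M euclidean_mfd \<phi> i k p.
         metric euclidean_mfd k (\<phi> p) (differential M euclidean_mfd \<phi> i k p X) (differential M euclidean_mfd \<phi> i k p Y)
         = (sqrt (c p))\<^sup>2 * metric M i p X Y)"
      using c(2)[OF p] c(1)[OF p(1)] unfolding conformal_on_horizontal_def horizontal_space_def by simp
  qed
qed

section \<open>Direct sums\<close>

text \<open>The computation $\Delta F = \Delta_M F$,
  $\Delta^2 F = \Delta_M^2 F + \Delta_N \Delta_M F = \Delta_M^2 F + \Delta_M \Delta_N F = 0$ in a
  product chart.\<close>

lemma product_bilaplacian:
  fixes M :: "('i, 'p, 'm::finite) rmfd" and N :: "('j, 'q, 'n::finite) rmfd"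
  assumes M: "smooth_atlas M" "riemannian_metric M" "i \<in> index M"
    and N: "smooth_atlas N" "riemannian_metric N" "j \<in> index N"
    and S: "open S" "smooth_on F S"
      "\<And>w. w \<in> S \<Longrightarrow> left_vec w \<in> chart M i ` dom M i \<and> right_vec w \<in> chart N j ` dom N j"
    and harm: "\<And>x y. join_vec x y \<in> S \<Longrightarrow> coord_laplacian N j (\<lambda>y. F (join_vec x y)) y = 0"
    and biharm: "\<And>x y. join_vec x y \<in> S \<Longrightarrow>
      coord_laplacian M i (coord_laplacian M i (\<lambda>x. F (join_vec x y))) x = 0"
    and w: "join_vec x y \<in> S"
  shows "coord_laplacian (product_mfd M N) (i, j) F (join_vec x y) = coord_laplacian M i (\<lambda>x. F (join_vec x y)) x"
    and "coord_laplacian (product_mfd M N) (i, j) (coord_laplacian (product_mfd M N) (i, j) F) (join_vec x y) = 0"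
proof -
  let ?P = "product_mfd M N"
  let ?LM = "coord_laplacian M i" and ?LN = "coord_laplacian N j" and ?LP = "coord_laplacian ?P (i, j)"
  have lap: "?LP G (join_vec x y) = ?LM (\<lambda>x. G (join_vec x y)) x + ?LN (\<lambda>y. G (join_vec x y)) y"
    if "smooth_on G S" "join_vec x y \<in> S" for G x y
    using product_laplacian[OF M N _ S(1) that] S(3)[OF that(2)] by simp
  have LPF: "?LP F (join_vec x y) = ?LM (\<lambda>x. F (join_vec x y)) x" if "join_vec x y \<in> S" for x y
    using lap[OF S(2) that] harm[OF that] by simp
  then show "?LP F (join_vec x y) = ?LM (\<lambda>x. F (join_vec x y)) x" using w .
  have ox: "open {x. join_vec x y \<in> S}" and oy: "open {y. join_vec x y \<in> S}"
    by (intro open_slice_left open_slice_right S)+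
  have "smooth_on (?LP F) S"
  proof (rule smooth_on_coord_laplacian[OF smooth_atlas_product[OF M(1) N(1)] riemannian_metric_product[OF M(1,2) N(1,2)] _ S(1) _ S(2)])
    show "(i, j) \<in> index ?P" using M N by simp
    show "S \<subseteq> chart ?P (i, j) ` dom ?P (i, j)"
      using S(3) by (auto simp: product_chart_image)
  qed
  from lap[OF this w] have "?LP (?LP F) (join_vec x y) = ?LM (\<lambda>x. ?LP F (join_vec x y)) x + ?LN (\<lambda>y. ?LP F (join_vec x y)) y" .
  also have "?LM (\<lambda>x. ?LP F (join_vec x y)) x = ?LM (?LM (\<lambda>x. F (join_vec x y))) x"
    unfolding coord_laplacian_eq[of M] 
    by (rule second_order_op_cong_open[OF ox]) (use w LPF in \<open>auto simp: coord_laplacian_eq[of M]\<close>)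
  also have "\<dots> = 0" by (rule biharm[OF w])
  also have "?LN (\<lambda>y. ?LP F (join_vec x y)) y = ?LN (\<lambda>y. ?LM (\<lambda>x. F (join_vec x y)) x) y"
    unfolding coord_laplacian_eq[of N] 
    by (rule second_order_op_cong_open[OF oy]) (use w LPF in auto)
  also have "\<dots> = ?LM (\<lambda>x. ?LN (\<lambda>y. F (join_vec x y)) y) x"
    unfolding coord_laplacian_eq by (rule second_order_op_slices_commute[OF S(1,2) w])
  also have "\<dots> = ?LM (\<lambda>x. 0) x"
    unfolding coord_laplacian_eq[of M] 
    by (rule second_order_op_cong_open[OF ox]) (use w harm in auto)
  also have "\<dots> = 0" by (simp add: coord_laplacian_eq second_order_op_const)
  finally show "?LP (?LP F) (join_vec x y) = 0" by simp
qed

lemma smooth_map_direct_sum: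
  fixes M :: "('i, 'p, 'm::finite) rmfd" and N :: "('j, 'q, 'n::finite) rmfd" and \<psi> :: "'p \<Rightarrow> real^'k::finite"
  assumes M: "smooth_atlas M" and N: "smooth_atlas N"
    and \<psi>: "smooth_map M euclidean_mfd \<psi>" and \<phi>: "smooth_map N euclidean_mfd \<phi>"
  shows "smooth_map (product_mfd M N) euclidean_mfd (map_direct_sum \<psi> \<phi>)"
  unfolding smooth_map_def
proof (intro conjI ballI)
  let ?P = "product_mfd M N" and ?\<Phi> = "map_direct_sum \<psi> \<phi>"
  have c: "continuous_map (carrier_top M) euclidean \<psi>" "continuous_map (carrier_top N) euclidean \<phi>"
    using \<psi> \<phi> by (simp_all add: smooth_map_def)
  have "continuous_map (carrier_top ?P) euclidean (\<lambda>z. (\<psi> \<circ> fst) z + (\<phi> \<circ> snd) z)"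
    unfolding product_mfd_simps
    by (intro continuous_map_add continuous_map_compose[OF continuous_map_fst c(1)] continuous_map_compose[OF continuous_map_snd c(2)])
  then show "continuous_map (carrier_top ?P) (carrier_top euclidean_mfd) ?\<Phi>"
    by (simp add: map_direct_sum_def case_prod_unfold)
  fix k e assume "k \<in> index ?P" "e \<in> index (euclidean_mfd :: (unit, real^'k, 'k) rmfd)"
  then obtain i j where k: "k = (i, j)" "i \<in> index M" "j \<in> index N" by auto
  let ?O = "chart ?P k ` dom ?P k"
  have oO: "open ?O" using atlas_chart(2)[OF smooth_atlas_product[OF M N], of k] k by simp
  have O: "left_vec w \<in> chart M i ` dom M i" "right_vec w \<in> chart N j ` dom N j" if "w \<in> ?O" for w
    using that by (simp_all add: k(1) product_chart_image)
  have "smooth_on (\<lambda>w. ?\<Phi> (chart_inv ?P k w)) ?O"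
  proof (rule smooth_on_cong[OF oO])
    show "smooth_on (\<lambda>w. \<psi> (chart_inv M i (left_vec w)) + \<phi> (chart_inv N j (right_vec w))) ?O"
      using O by (intro smooth_on_add oO
        smooth_on_comp_vec[OF oO atlas_chart(2)[OF M k(2)] smooth_map_euclidean[OF \<psi> k(2)] smooth_on_linear[OF bounded_linear_left_vec]]
        smooth_on_comp_vec[OF oO atlas_chart(2)[OF N k(3)] smooth_map_euclidean[OF \<phi> k(3)] smooth_on_linear[OF bounded_linear_right_vec]]) auto
  qed (simp add: k(1) product_chart_inv[OF M N k(2,3) O] map_direct_sum_def)
  then show "smooth_on (chart euclidean_mfd e \<circ> ?\<Phi> \<circ> chart_inv ?P k) (chart ?P k ` (dom ?P k \<inter> ?\<Phi> -` dom euclidean_mfd e))"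
    by (simp add: o_def)
qed

text \<open>The Laplacian of the pullback is assembled from the Laplacians of its restrictions to the slices
  \<open>M \<times> {y}\<close>; in each product chart the hypotheses of \<open>product_bilaplacian\<close> are the properties of the
  two maps applied to translates of \<open>f\<close>.\<close>

theorem generalized_harmonic_morphism_direct_sum:
  fixes M :: "('i, 'p, 'm::finite) rmfd" and N :: "('j, 'q, 'n::finite) rmfd" and \<psi> :: "'p \<Rightarrow> real^'k::finite"
  assumes M: "smooth_atlas M" "riemannian_metric M" and N: "smooth_atlas N" "riemannian_metric N"
    and \<psi>: "generalized_harmonic_morphism M euclidean_mfd \<psi>" and \<phi>: "harmonic_morphism N euclidean_mfd \<phi>"
  shows "generalized_harmonic_morphism (product_mfd M N) euclidean_mfd (map_direct_sum \<psi> \<phi>)"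
  unfolding generalized_harmonic_morphism_def
proof (intro conjI allI impI)
  let ?P = "product_mfd M N" and ?\<Phi> = "map_direct_sum \<psi> \<phi>"
  have sm: "smooth_map M euclidean_mfd \<psi>" "smooth_map N euclidean_mfd \<phi>"
    using \<psi> \<phi> by (auto simp: generalized_harmonic_morphism_def harmonic_morphism_def)
  show sP: "smooth_map ?P euclidean_mfd ?\<Phi>" by (rule smooth_map_direct_sum[OF M(1) N(1) sm])
  have atP: "smooth_atlas ?P" by (rule smooth_atlas_product[OF M(1) N(1)])
  fix U and f :: "real^'k \<Rightarrow> real"
  assume "openin (carrier_top euclidean_mfd) U \<and> points ?P \<inter> ?\<Phi> -` U \<noteq> {} \<and> harmonic_on euclidean_mfd U f"
  then have U: "open U" and f: "harmonic_on euclidean_mfd U f" by auto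
  let ?W = "points ?P \<inter> ?\<Phi> -` U"
  define WM where "WM y = points M \<inter> (\<lambda>x. \<psi> x + \<phi> y) -` U" for y
  define WN where "WN x = points N \<inter> (\<lambda>y. \<psi> x + \<phi> y) -` U" for x
  have W: "(x, y) \<in> ?W \<longleftrightarrow> x \<in> WM y \<and> y \<in> points N" "(x, y) \<in> ?W \<longleftrightarrow> y \<in> WN x \<and> x \<in> points M" for x y
    by (auto simp: WM_def WN_def map_direct_sum_def)
  have oW: "openin (carrier_top ?P) ?W"
    using openin_continuous_map_preimage[of "carrier_top ?P" euclidean ?\<Phi> U] sP U
    by (simp add: smooth_map_def vimage_def Int_def)
  \<comment> \<open>Translates of \<open>f\<close> are harmonic, so \<open>f \<circ> (\<psi> \<oplus> \<phi>)\<close> is biharmonic in the first and harmonic in the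
    second variable.\<close>
  have tr: "open {z. z + b \<in> U}" for b
    using open_vimage[OF U, of "\<lambda>z. z + b"] by (simp add: vimage_def continuous_intros)
  have bih: "biharmonic_on M (WM y) (\<lambda>x. f (\<psi> x + \<phi> y))" if "WM y \<noteq> {}" for y
  proof -
    have "WM y = points M \<inter> \<psi> -` {z. z + \<phi> y \<in> U}" by (auto simp: WM_def)
    moreover have "biharmonic_on M (points M \<inter> \<psi> -` {z. z + \<phi> y \<in> U}) ((\<lambda>z. f (z + \<phi> y)) \<circ> \<psi>)"
      if "points M \<inter> \<psi> -` {z. z + \<phi> y \<in> U} \<noteq> {}"
      by (rule generalized_harmonic_morphismD[OF \<psi> tr that harmonic_on_translate[OF U f]])
    ultimately show ?thesis using that by (simp add: o_def)
  qed
  have hrm: "harmonic_on N (WN x) (\<lambda>y. f (\<psi> x + \<phi> y))" if "WN x \<noteq> {}" for x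
  proof -
    have "WN x = points N \<inter> \<phi> -` {z. z + \<psi> x \<in> U}" by (auto simp: WN_def add.commute)
    moreover have "harmonic_on N (points N \<inter> \<phi> -` {z. z + \<psi> x \<in> U}) ((\<lambda>z. f (z + \<psi> x)) \<circ> \<phi>)"
      if "points N \<inter> \<phi> -` {z. z + \<psi> x \<in> U} \<noteq> {}"
      by (rule harmonic_morphismD[OF \<phi> tr that harmonic_on_translate[OF U f]])
    ultimately show ?thesis using that by (simp add: o_def add.commute)
  qed
  have oWM: "openin (carrier_top M) (WM y)" for y
  proof -
    have "continuous_map (carrier_top M) euclidean (\<lambda>x. \<psi> x + \<phi> y)"
      using sm by (intro continuous_map_add) (simp_all add: smooth_map_def)
    then show ?thesis
      using openin_continuous_map_preimage[of "carrier_top M" euclidean _ U] U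
      by (fastforce simp: WM_def vimage_def Int_def)
  qed
  have oWN: "openin (carrier_top N) (WN x)" for x
  proof -
    have "continuous_map (carrier_top N) euclidean (\<lambda>y. \<psi> x + \<phi> y)"
      using sm by (intro continuous_map_add) (simp_all add: smooth_map_def)
    then show ?thesis
      using openin_continuous_map_preimage[of "carrier_top N" euclidean _ U] U
      by (fastforce simp: WN_def vimage_def Int_def)
  qed
  \<comment> \<open>The Laplacians of the slices, one for each \<open>y\<close>, together form the Laplacian on the product.\<close>
  have "\<forall>y. \<exists>u. WM y \<noteq> {} \<longrightarrow> has_laplacian M (WM y) (\<lambda>x. f (\<psi> x + \<phi> y)) u"
    using bih unfolding biharmonic_on_def by blast
  then obtain u where u: "\<And>y. WM y \<noteq> {} \<Longrightarrow> has_laplacian M (WM y) (\<lambda>x. f (\<psi> x + \<phi> y)) (u y)" by metis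
  let ?u = "\<lambda>(x, y). u y x"
  have key: "smooth_on ((f \<circ> ?\<Phi>) \<circ> chart_inv ?P (i, j)) (chart ?P (i, j) ` (dom ?P (i, j) \<inter> ?W)) \<and>
      (\<forall>(x, y)\<in>dom ?P (i, j) \<inter> ?W.
        u y x = coord_laplacian ?P (i, j) ((f \<circ> ?\<Phi>) \<circ> chart_inv ?P (i, j)) (chart ?P (i, j) (x, y)) \<and>
        coord_laplacian ?P (i, j) (coord_laplacian ?P (i, j) ((f \<circ> ?\<Phi>) \<circ> chart_inv ?P (i, j))) (chart ?P (i, j) (x, y)) = 0)"
    if i: "i \<in> index M" and j: "j \<in> index N" for i j
  proof -
    have ij: "(i, j) \<in> index ?P" using i j by simp
    let ?S = "chart ?P (i, j) ` (dom ?P (i, j) \<inter> ?W)" and ?F = "(f \<circ> ?\<Phi>) \<circ> chart_inv ?P (i, j)"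
    have oS: "open ?S" by (rule open_chart_image[OF atP ij oW])
    have Sd: "left_vec w \<in> chart M i ` dom M i \<and> right_vec w \<in> chart N j ` dom N j" if "w \<in> ?S" for w
      using that by auto
    have F: "?F w = f (\<psi> (chart_inv M i (left_vec w)) + \<phi> (chart_inv N j (right_vec w)))" if "w \<in> ?S" for w
      using Sd[OF that] by (simp add: product_chart_inv[OF M(1) N(1) i j] map_direct_sum_def)
    have S: "join_vec x y \<in> ?S \<longleftrightarrow> x \<in> chart M i ` dom M i \<and> y \<in> chart N j ` dom N j \<and> \<psi> (chart_inv M i x) + \<phi> (chart_inv N j y) \<in> U" for x y
    proof -
      have pts: "chart_inv M i x \<in> points M" if "x \<in> chart M i ` dom M i"
        using chart_inv_in(1)[OF that] atlas_chart(4)[OF M(1) i] by blast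
      have ptsN: "chart_inv N j y \<in> points N" if "y \<in> chart N j ` dom N j"
        using chart_inv_in(1)[OF that] atlas_chart(4)[OF N(1) j] by blast
      have "join_vec x y \<in> ?S \<longleftrightarrow> join_vec x y \<in> chart ?P (i, j) ` dom ?P (i, j) \<and> chart_inv ?P (i, j) (join_vec x y) \<in> ?W"
        by (rule chart_image_Int_iff[OF atP ij])
      also have "\<dots> \<longleftrightarrow> x \<in> chart M i ` dom M i \<and> y \<in> chart N j ` dom N j \<and> \<psi> (chart_inv M i x) + \<phi> (chart_inv N j y) \<in> U"
        using pts ptsN by (auto simp: product_chart_image product_chart_inv[OF M(1) N(1) i j] map_direct_sum_def simp del: image_iff)
      finally show ?thesis .
    qed
    have sF: "smooth_on ?F ?S"
    proof -
      have "smooth_on (\<lambda>w. f (?\<Phi> (chart_inv ?P (i, j) w))) ?S"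
      proof (rule smooth_on_comp[OF oS])
        show "smooth_on f U" using f by (simp add: harmonic_on_euclidean)
        show "smooth_on (\<lambda>w. ?\<Phi> (chart_inv ?P (i, j) w)) ?S"
          by (rule smooth_on_subset[OF smooth_map_euclidean[OF sP ij]]) (rule image_mono, rule Int_lower1)
        show "(\<lambda>w. ?\<Phi> (chart_inv ?P (i, j) w)) ` ?S \<subseteq> U"
          using chart_inv_chart[OF atP ij] by (auto simp del: product_mfd_simps)
      qed
      then show ?thesis by (simp add: o_def)
    qed
    have sl: "?F (join_vec x y) = f (\<psi> (chart_inv M i x) + \<phi> (chart_inv N j y))" if "join_vec x y \<in> ?S" for x y
      using F[OF that] by simp
    have harm: "coord_laplacian N j (\<lambda>y. ?F (join_vec x y)) y = 0" if xy: "join_vec x y \<in> ?S" for x y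
    proof -
      have q: "chart_inv N j y \<in> dom N j \<inter> WN (chart_inv M i x)" "chart N j (chart_inv N j y) = y"
        using xy chart_inv_in[of y N j] atlas_chart(4)[OF N(1) j] unfolding S by (auto simp: WN_def)
      have "coord_laplacian N j (\<lambda>y. ?F (join_vec x y)) y = coord_laplacian N j ((\<lambda>y. f (\<psi> (chart_inv M i x) + \<phi> y)) \<circ> chart_inv N j) y"
        unfolding coord_laplacian_eq
        by (rule second_order_op_cong_open[OF open_slice_right[OF oS, of x]]) (use xy sl in auto)
      also have "\<dots> = 0"
        using harmonic_on_chart[OF hrm j q(1)] q(1) unfolding q(2) by blast
      finally show ?thesis .
    qed
    have slM: "coord_laplacian M i (\<lambda>x. ?F (join_vec x y)) x = coord_laplacian M i ((\<lambda>x. f (\<psi> x + \<phi> (chart_inv N j y))) \<circ> chart_inv M i) x"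
      if xy: "join_vec x y \<in> ?S" for x y
      unfolding coord_laplacian_eq
      by (rule second_order_op_cong_open[OF open_slice_left[OF oS, of y]]) (use xy sl in auto)
    have biharm: "coord_laplacian M i (coord_laplacian M i (\<lambda>x. ?F (join_vec x y))) x = 0" if xy: "join_vec x y \<in> ?S" for x y
    proof -
      have q: "chart_inv M i x \<in> dom M i \<inter> WM (chart_inv N j y)" "chart M i (chart_inv M i x) = x"
        using xy chart_inv_in[of x M i] atlas_chart(4)[OF M(1) i] unfolding S by (auto simp: WM_def)
      have "coord_laplacian M i (coord_laplacian M i (\<lambda>x. ?F (join_vec x y))) x
        = coord_laplacian M i (coord_laplacian M i ((\<lambda>x. f (\<psi> x + \<phi> (chart_inv N j y))) \<circ> chart_inv M i)) x"
        unfolding coord_laplacian_eq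
        by (rule second_order_op_cong_open[OF open_slice_left[OF oS, of y]])
          (use xy slM in \<open>auto simp: coord_laplacian_eq\<close>)
      also have "\<dots> = 0"
        using biharmonic_on_chart[OF M(1) i oWM bih q(1)] q(1) unfolding q(2) by blast
      finally show ?thesis .
    qed
    have pb: "coord_laplacian ?P (i, j) ?F (join_vec x y) = coord_laplacian M i (\<lambda>x. ?F (join_vec x y)) x"
      "coord_laplacian ?P (i, j) (coord_laplacian ?P (i, j) ?F) (join_vec x y) = 0"
      if xy: "join_vec x y \<in> ?S" for x y
      by (rule product_bilaplacian[OF M i N j oS sF _ _ _ xy], fact Sd, fact harm, fact biharm)+
    have "u y x = coord_laplacian ?P (i, j) ?F (chart ?P (i, j) (x, y)) \<and>
        coord_laplacian ?P (i, j) (coord_laplacian ?P (i, j) ?F) (chart ?P (i, j) (x, y)) = 0"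
      if xy: "(x, y) \<in> dom ?P (i, j) \<inter> ?W" for x y
    proof -
      have j': "join_vec (chart M i x) (chart N j y) \<in> ?S"
        using imageI[OF xy, of "chart ?P (i, j)"] by (simp only: product_mfd_simps)
      have x: "x \<in> dom M i" "y \<in> dom N j" "x \<in> WM y" using xy W by auto
      have "u y x = coord_laplacian M i ((\<lambda>x. f (\<psi> x + \<phi> y)) \<circ> chart_inv M i) (chart M i x)"
        using u[of y] x i by (auto simp: has_laplacian_def)
      then show ?thesis
        using pb[OF j'] slM[OF j'] chart_inv_chart[OF N(1) j x(2)] by simp
    qed
    with sF show ?thesis by blast
  qed
  have lap: "?u p = coord_laplacian ?P k ((f \<circ> ?\<Phi>) \<circ> chart_inv ?P k) (chart ?P k p)"
    and bilap: "coord_laplacian ?P k (coord_laplacian ?P k ((f \<circ> ?\<Phi>) \<circ> chart_inv ?P k)) (chart ?P k p) = 0"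
    if k: "k \<in> index ?P" and p: "p \<in> dom ?P k \<inter> ?W" for k p
  proof -
    obtain i j where kij: "k = (i, j)" "i \<in> index M" "j \<in> index N" using k by auto
    from key[OF kij(2,3), THEN conjunct2, rule_format, OF p[unfolded kij(1)]]
    show "?u p = coord_laplacian ?P k ((f \<circ> ?\<Phi>) \<circ> chart_inv ?P k) (chart ?P k p)"
      "coord_laplacian ?P k (coord_laplacian ?P k ((f \<circ> ?\<Phi>) \<circ> chart_inv ?P k)) (chart ?P k p) = 0"
      unfolding kij(1) by (simp_all only: split_beta prod.collapse)
  qed
  show "biharmonic_on ?P ?W (f \<circ> ?\<Phi>)"
    unfolding biharmonic_on_def
  proof (intro conjI exI[of _ ?u])
    show "smooth_fun_on ?P ?W (f \<circ> ?\<Phi>)"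
      unfolding smooth_fun_on_def
    proof
      fix k assume "k \<in> index ?P"
      then obtain i j where kij: "k = (i, j)" "i \<in> index M" "j \<in> index N" by auto
      show "smooth_on (f \<circ> ?\<Phi> \<circ> chart_inv ?P k) (chart ?P k ` (dom ?P k \<inter> ?W))"
        unfolding kij(1) by (rule key[OF kij(2,3), THEN conjunct1])
    qed
    show "has_laplacian ?P ?W (f \<circ> ?\<Phi>) ?u"
      unfolding has_laplacian_def by (intro ballI lap)
    show "has_laplacian ?P ?W ?u (\<lambda>_. 0)"
      unfolding has_laplacian_def
    proof (intro ballI)
      fix k p assume k: "k \<in> index ?P" and p: "p \<in> dom ?P k \<inter> ?W"
      have "coord_laplacian ?P k (?u \<circ> chart_inv ?P k) (chart ?P k p) =
         coord_laplacian ?P k (coord_laplacian ?P k ((f \<circ> ?\<Phi>) \<circ> chart_inv ?P k)) (chart ?P k p)"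
        unfolding coord_laplacian_eq[of ?P k "?u \<circ> chart_inv ?P k"] coord_laplacian_eq[of ?P k "coord_laplacian ?P k ((f \<circ> ?\<Phi>) \<circ> chart_inv ?P k)"]
      proof (rule second_order_op_cong_open[OF open_chart_image[OF atP k oW]])
        fix x assume "x \<in> chart ?P k ` (dom ?P k \<inter> ?W)"
        then obtain q where q: "q \<in> dom ?P k \<inter> ?W" "x = chart ?P k q" by blast
        then have "chart_inv ?P k x = q" using chart_inv_chart[OF atP k] by blast
        then show "(?u \<circ> chart_inv ?P k) x = coord_laplacian ?P k ((f \<circ> ?\<Phi>) \<circ> chart_inv ?P k) x"
          unfolding o_apply[of ?u] using lap[OF k q(1)] q(2) by metis
      qed (use p in blast)
      then show "0 = coord_laplacian ?P k (?u \<circ> chart_inv ?P k) (chart ?P k p)" using bilap[OF k p] by metis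
    qed
  qed
qed

text \<open>Componentwise, the Laplacian of the sum is the sum of the Laplacians of the summands, and that of the
  second one is zero. A point of \<open>N\<close> is needed to restrict to a slice.\<close>

lemma harmonic_map_direct_sumD:
  fixes M :: "('i, 'p, 'm::finite) rmfd" and N :: "('j, 'q, 'n::finite) rmfd" and \<psi> :: "'p \<Rightarrow> real^'k::finite"
  assumes M: "smooth_atlas M" "riemannian_metric M" and N: "smooth_atlas N" "riemannian_metric N" "points N \<noteq> {}"
    and \<psi>: "smooth_map M euclidean_mfd \<psi>" and \<phi>: "harmonic_map N \<phi>"
    and sum: "harmonic_map (product_mfd M N) (map_direct_sum \<psi> \<phi>)"
  shows "harmonic_map M \<psi>"
  unfolding harmonic_map_def harmonic_on_def
proof (intro conjI allI \<psi>)
  let ?P = "product_mfd M N" and ?\<Phi> = "map_direct_sum \<psi> \<phi>"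
  fix l
  have sM: "smooth_on (\<lambda>x. \<psi> (chart_inv M i x) $ l) (chart M i ` dom M i)" if "i \<in> index M" for i
    using smooth_map_euclidean[OF \<psi> that] atlas_chart(2)[OF M(1) that] by (simp add: smooth_on_vec_iff)
  have \<phi>s: "smooth_map N euclidean_mfd \<phi>" using \<phi> by (simp add: harmonic_map_def)
  have sN: "smooth_on (\<lambda>y. \<phi> (chart_inv N j y) $ l) (chart N j ` dom N j)" if "j \<in> index N" for j
    using smooth_map_euclidean[OF \<phi>s that] atlas_chart(2)[OF N(1) that] by (simp add: smooth_on_vec_iff)
  show "smooth_fun_on M (points M) (\<lambda>p. \<psi> p $ l)"
    using sM atlas_chart(4)[OF M(1)] by (simp add: smooth_fun_on_def o_def Int_absorb2)
  show "has_laplacian M (points M) (\<lambda>p. \<psi> p $ l) (\<lambda>_. 0)"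
    unfolding has_laplacian_def
  proof (intro ballI)
    fix i x assume i: "i \<in> index M" and x: "x \<in> dom M i \<inter> points M"
    obtain y j where j: "j \<in> index N" and y: "y \<in> dom N j" "y \<in> points N"
      using N(3) atlas_cover[OF N(1)] by blast
    let ?w = "join_vec (chart M i x) (chart N j y)"
    let ?F = "(\<lambda>p. ?\<Phi> p $ l) \<circ> chart_inv ?P (i, j)"
    let ?S = "{w. left_vec w \<in> chart M i ` dom M i \<and> right_vec w \<in> chart N j ` dom N j}"
    have oS: "open ?S" by (intro open_left_right atlas_chart(2) M N i j)
    have w: "?w \<in> ?S" using x y by simp
    have F: "?F v = \<psi> (chart_inv M i (left_vec v)) $ l + \<phi> (chart_inv N j (right_vec v)) $ l" if "v \<in> ?S" for v
      using that by (simp add: product_chart_inv[OF M(1) N(1) i j] map_direct_sum_def)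
    have sF: "smooth_on ?F ?S"
    proof (rule smooth_on_cong[OF oS])
      show "smooth_on (\<lambda>v. \<psi> (chart_inv M i (left_vec v)) $ l + \<phi> (chart_inv N j (right_vec v)) $ l) ?S"
        by (intro smooth_on_add oS smooth_on_comp_left_right(1)[OF oS sM[OF i]] smooth_on_comp_left_right(2)[OF oS sN[OF j]]) auto
    qed (simp only: F)
    note oM = atlas_chart(2)[OF M(1) i] and oN = atlas_chart(2)[OF N(1) j]
    have xi: "chart M i x \<in> chart M i ` dom M i" and yj: "chart N j y \<in> chart N j ` dom N j" using x y by auto
    have "coord_laplacian ?P (i, j) ?F ?w = 0"
      using harmonic_on_chart[of ?P "points ?P" "\<lambda>p. ?\<Phi> p $ l" "(i, j)" "(x, y)"] sum i j x y by (simp add: harmonic_map_def)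
    then have "coord_laplacian M i (\<lambda>u. ?F (join_vec u (chart N j y))) (chart M i x)
        + coord_laplacian N j (\<lambda>v. ?F (join_vec (chart M i x) v)) (chart N j y) = 0"
      using product_laplacian[OF M i N(1,2) j w oS sF w] by simp
    also have "coord_laplacian M i (\<lambda>u. ?F (join_vec u (chart N j y))) (chart M i x)
        = coord_laplacian M i (\<lambda>u. \<psi> (chart_inv M i u) $ l + \<phi> (chart_inv N j (chart N j y)) $ l) (chart M i x)"
      unfolding coord_laplacian_eq
      by (rule second_order_op_cong_open[OF oM xi]) (subst F, use yj in auto)
    also have "\<dots> = coord_laplacian M i (\<lambda>u. \<psi> (chart_inv M i u) $ l) (chart M i x)"
      unfolding coord_laplacian_eq second_order_op_add[OF oM sM[OF i] smooth_on_const xi] second_order_op_const by simp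
    also have "coord_laplacian N j (\<lambda>v. ?F (join_vec (chart M i x) v)) (chart N j y)
        = coord_laplacian N j (\<lambda>v. \<psi> (chart_inv M i (chart M i x)) $ l + \<phi> (chart_inv N j v) $ l) (chart N j y)"
      unfolding coord_laplacian_eq
      by (rule second_order_op_cong_open[OF oN yj]) (subst F, use xi in auto)
    also have "\<dots> = coord_laplacian N j (\<lambda>v. \<phi> (chart_inv N j v) $ l) (chart N j y)"
      unfolding coord_laplacian_eq second_order_op_add[OF oN smooth_on_const sN[OF j] yj] second_order_op_const by simp
    also have "\<dots> = 0"
      using harmonic_on_chart[of N "points N" "\<lambda>p. \<phi> p $ l" j y] \<phi> j y by (simp add: harmonic_map_def o_def)
    finally show "0 = coord_laplacian M i ((\<lambda>p. \<psi> p $ l) \<circ> chart_inv M i) (chart M i x)"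
      by (simp add: o_def)
  qed
qed

lemma generalized_harmonic_morphism_biharmonic_map:
  fixes \<phi> :: "'p \<Rightarrow> real^'k::finite"
  assumes "generalized_harmonic_morphism M euclidean_mfd \<phi>" "points M \<noteq> {}"
  shows "biharmonic_map M \<phi>"
  using assms generalized_harmonic_morphismD[OF assms(1) open_UNIV _ harmonic_on_vec_nth]
  by (simp add: biharmonic_map_def generalized_harmonic_morphism_def o_def)

lemma harmonic_morphism_harmonic_map:
  fixes \<phi> :: "'p \<Rightarrow> real^'k::finite"
  assumes "harmonic_morphism M euclidean_mfd \<phi>" "points M \<noteq> {}"
  shows "harmonic_map M \<phi>"
  using assms harmonic_morphismD[OF assms(1) open_UNIV _ harmonic_on_vec_nth]
  by (simp add: harmonic_map_def harmonic_morphism_def o_def)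

theorem proposition3p2:
  fixes M :: "('i, 'p, 'm::finite) rmfd"
    and N :: "('j, 'q, 'n::finite) rmfd"
    and \<psi> :: "'p \<Rightarrow> real^'k::finite"
    and \<phi> :: "'q \<Rightarrow> real^'k"
  assumes "riemannian_manifold M" and "riemannian_manifold N"
    and "generalized_harmonic_morphism M euclidean_mfd \<psi>"
    and "harmonic_morphism N euclidean_mfd \<phi>"
  shows "generalized_harmonic_morphism (product_mfd M N) euclidean_mfd (map_direct_sum \<psi> \<phi>) \<and>
    horizontally_weakly_conformal (product_mfd M N) euclidean_mfd (map_direct_sum \<psi> \<phi>) \<and>
    biharmonic_map (product_mfd M N) (map_direct_sum \<psi> \<phi>) \<and>
    (\<not> harmonic_map M \<psi> \<longrightarrow> proper_biharmonic_map (product_mfd M N) (map_direct_sum \<psi> \<phi>))"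
proof -
  have M: "smooth_atlas M" "riemannian_metric M" "points M \<noteq> {}"
    and N: "smooth_atlas N" "riemannian_metric N" "points N \<noteq> {}"
    using assms(1,2) by (auto simp: riemannian_manifold_def)
  have sm: "smooth_map M euclidean_mfd \<psi>"
    using assms(3) by (simp add: generalized_harmonic_morphism_def)
  have gen: "generalized_harmonic_morphism (product_mfd M N) euclidean_mfd (map_direct_sum \<psi> \<phi>)"
    by (rule generalized_harmonic_morphism_direct_sum[OF M(1,2) N(1,2) assms(3,4)])
  have hwc: "horizontally_weakly_conformal (product_mfd M N) euclidean_mfd (map_direct_sum \<psi> \<phi>)"
    by (rule generalized_harmonic_morphism_horizontally_weakly_conformal
        [OF smooth_atlas_product[OF M(1) N(1)] riemannian_metric_product[OF M(1,2) N(1,2)] gen])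
  have bih: "biharmonic_map (product_mfd M N) (map_direct_sum \<psi> \<phi>)"
    by (rule generalized_harmonic_morphism_biharmonic_map[OF gen]) (use M N in simp)
  have "harmonic_map M \<psi>" if "harmonic_map (product_mfd M N) (map_direct_sum \<psi> \<phi>)"
    by (rule harmonic_map_direct_sumD[OF M(1,2) N sm harmonic_morphism_harmonic_map[OF assms(4) N(3)] that])
  with gen hwc bih show ?thesis by (auto simp: proper_biharmonic_map_def)
qed

end
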